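(* Let $\Theta$ be an $n\times n$ matrix inner function, $p\in(2,\infty]$, and let $G\in L^{(p,n\times n)}$ be such that $A_G^\Theta$ is a MTTO. Then $\ker A_G^\Theta$ is nearly $S^*$-invariant with defect $m$ for some $m\le n$; that is, there is a subspace $D\subseteq(H^2)^n$ with $\dim D=m\le n$ such that whenever $f\in\ker A_G^\Theta$ and $f(0)=0$, we have $S^*f\in\ker A_G^\Theta+D$.
   Context: $\mathbb T$ is the unit circle; $L^p,H^p$ are Lebesgue/Hardy spaces on $\mathbb T$; $(L^p)^n,(H^p)^n$ are length-$n$ column vectors with entries in these spaces; $L^{(p,n\times n)}$ is the space of $n\times n$ matrices with entries in $L^p$. An $n\times n$ matrix inner function is an $n\times n$ matrix $\Theta$ with $H^\infty$ entries and $\Theta(z)$ unitary a.e. on $\mathbb T$. $K^2_\Theta=(H^2)^n\ominus\Theta(H^2)^n$ is the model space and $P_{\Theta,2}$ the orthogonal projection of $(L^2)^n$ onto it. MTTO: for $G\in L^{(2,n\times n)}$ consider $f\mapsto P_{\Theta,2}(Gf)$ on $K^2_\Theta\cap(H^\infty)^n$, which is dense in $K^2_\Theta$; when this map is bounded in the $L^2$ norm, its bounded extension $A_G^\Theta:K^2_\Theta\to K^2_\Theta$ is called a MTTO. The backward shift is $S^*f=(f-f(0))/z$. *)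

theory Defs
  imports "HOL-Analysis.Analysis"
begin

text \<open>The unit circle is parametrised by t in [0, 2 pi] (point exp(i t)), with Lebesgue
measure. Vectors in C^n are functions 'n => complex for a finite index type 'n
(n = CARD('n)); n x n matrices are functions 'n => 'n => complex.\<close>

definition circ :: "real measure" where
  "circ = lebesgue_on {0..2*pi}"

definition Lp_circ :: "ereal \<Rightarrow> (real \<Rightarrow> complex) \<Rightarrow> bool" where
  "Lp_circ p f \<longleftrightarrow> f \<in> borel_measurable circ \<and>
     (if p = \<infinity> then (\<exists>C. AE t in circ. norm (f t) \<le> C)
      else integrable circ (\<lambda>t. norm (f t) powr real_of_ereal p))"

definition fcoef :: "(real \<Rightarrow> complex) \<Rightarrow> int \<Rightarrow> complex" where
  "fcoef f k = (1 / (2 * pi)) * (\<integral>t. f t * exp (- \<i> * of_int k * of_real t) \<partial>circ)"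

definition Hp_circ :: "ereal \<Rightarrow> (real \<Rightarrow> complex) \<Rightarrow> bool" where
  "Hp_circ p f \<longleftrightarrow> Lp_circ p f \<and> (\<forall>k<0. fcoef f k = 0)"

definition vLp :: "ereal \<Rightarrow> (real \<Rightarrow> 'n::finite \<Rightarrow> complex) \<Rightarrow> bool" where
  "vLp p F \<longleftrightarrow> (\<forall>i. Lp_circ p (\<lambda>t. F t i))"

definition vHp :: "ereal \<Rightarrow> (real \<Rightarrow> 'n::finite \<Rightarrow> complex) \<Rightarrow> bool" where
  "vHp p F \<longleftrightarrow> (\<forall>i. Hp_circ p (\<lambda>t. F t i))"

definition mLp :: "ereal \<Rightarrow> (real \<Rightarrow> 'n::finite \<Rightarrow> 'n \<Rightarrow> complex) \<Rightarrow> bool" where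
  "mLp p G \<longleftrightarrow> (\<forall>i j. Lp_circ p (\<lambda>t. G t i j))"

definition mvmult :: "(real \<Rightarrow> 'n::finite \<Rightarrow> 'n \<Rightarrow> complex) \<Rightarrow> (real \<Rightarrow> 'n \<Rightarrow> complex)
    \<Rightarrow> real \<Rightarrow> 'n \<Rightarrow> complex" where
  "mvmult G F = (\<lambda>t i. \<Sum>j\<in>UNIV. G t i j * F t j)"

definition matrix_inner :: "(real \<Rightarrow> 'n::finite \<Rightarrow> 'n \<Rightarrow> complex) \<Rightarrow> bool" where
  "matrix_inner \<Theta> \<longleftrightarrow> (\<forall>i j. Hp_circ \<infinity> (\<lambda>t. \<Theta> t i j)) \<and>
     (AE t in circ. \<forall>i j.
        (\<Sum>k\<in>UNIV. cnj (\<Theta> t k i) * \<Theta> t k j) = (if i = j then 1 else 0) \<and>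
        (\<Sum>k\<in>UNIV. \<Theta> t i k * cnj (\<Theta> t j k)) = (if i = j then 1 else 0))"

definition vinner :: "(real \<Rightarrow> 'n::finite \<Rightarrow> complex) \<Rightarrow> (real \<Rightarrow> 'n \<Rightarrow> complex) \<Rightarrow> complex" where
  "vinner F H = (\<integral>t. (\<Sum>i\<in>UNIV. F t i * cnj (H t i)) \<partial>circ)"

definition vnorm2 :: "(real \<Rightarrow> 'n::finite \<Rightarrow> complex) \<Rightarrow> real" where
  "vnorm2 F = sqrt (\<integral>t. (\<Sum>i\<in>UNIV. (cmod (F t i))\<^sup>2) \<partial>circ)"

definition model_space :: "(real \<Rightarrow> 'n::finite \<Rightarrow> 'n \<Rightarrow> complex) \<Rightarrow> (real \<Rightarrow> 'n \<Rightarrow> complex) set" where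
  "model_space \<Theta> = {f. vHp 2 f \<and> (\<forall>h. vHp 2 h \<longrightarrow> vinner f (mvmult \<Theta> h) = 0)}"

text \<open>v is (a representative of) the orthogonal projection P_{Theta,2} u.\<close>
definition is_PK :: "(real \<Rightarrow> 'n::finite \<Rightarrow> 'n \<Rightarrow> complex) \<Rightarrow> (real \<Rightarrow> 'n \<Rightarrow> complex)
    \<Rightarrow> (real \<Rightarrow> 'n \<Rightarrow> complex) \<Rightarrow> bool" where
  "is_PK \<Theta> u v \<longleftrightarrow> v \<in> model_space \<Theta> \<and>
     (\<forall>w\<in>model_space \<Theta>. vinner (\<lambda>t i. u t i - v t i) w = 0)"

text \<open>The dense domain K^2_Theta \<inter> (H^infinity)^n.\<close>
definition mtto_dom :: "(real \<Rightarrow> 'n::finite \<Rightarrow> 'n \<Rightarrow> complex) \<Rightarrow> (real \<Rightarrow> 'n \<Rightarrow> complex) set" where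
  "mtto_dom \<Theta> = {f \<in> model_space \<Theta>. vHp \<infinity> f}"

definition is_MTTO :: "(real \<Rightarrow> 'n::finite \<Rightarrow> 'n \<Rightarrow> complex) \<Rightarrow> (real \<Rightarrow> 'n \<Rightarrow> 'n \<Rightarrow> complex) \<Rightarrow> bool" where
  "is_MTTO \<Theta> G \<longleftrightarrow> (\<exists>C. \<forall>f\<in>mtto_dom \<Theta>. \<forall>v. is_PK \<Theta> (mvmult G f) v \<longrightarrow> vnorm2 v \<le> C * vnorm2 f)"

text \<open>Value of the bounded extension: A_G^Theta f = g iff for every sequence f_k in the dense
domain converging to f in L^2, P(G f_k) converges to g in L^2.\<close>
definition MTTO_ext :: "(real \<Rightarrow> 'n::finite \<Rightarrow> 'n \<Rightarrow> complex) \<Rightarrow> (real \<Rightarrow> 'n \<Rightarrow> 'n \<Rightarrow> complex)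
    \<Rightarrow> (real \<Rightarrow> 'n \<Rightarrow> complex) \<Rightarrow> (real \<Rightarrow> 'n \<Rightarrow> complex) \<Rightarrow> bool" where
  "MTTO_ext \<Theta> G f g \<longleftrightarrow> f \<in> model_space \<Theta> \<and>
     (\<forall>fs vs. (\<forall>k. fs k \<in> mtto_dom \<Theta> \<and> is_PK \<Theta> (mvmult G (fs k)) (vs k)) \<longrightarrow>
        (\<lambda>k. vnorm2 (\<lambda>t i. fs k t i - f t i)) \<longlonglongrightarrow> 0 \<longrightarrow>
        (\<lambda>k. vnorm2 (\<lambda>t i. vs k t i - g t i)) \<longlonglongrightarrow> 0)"

definition MTTO_ker :: "(real \<Rightarrow> 'n::finite \<Rightarrow> 'n \<Rightarrow> complex) \<Rightarrow> (real \<Rightarrow> 'n \<Rightarrow> 'n \<Rightarrow> complex)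
    \<Rightarrow> (real \<Rightarrow> 'n \<Rightarrow> complex) set" where
  "MTTO_ker \<Theta> G = {f. MTTO_ext \<Theta> G f (\<lambda>t i. 0)}"

text \<open>Value at 0 of an (H^2)^n function (0th Fourier coefficients) and backward shift.\<close>
definition val0 :: "(real \<Rightarrow> 'n::finite \<Rightarrow> complex) \<Rightarrow> 'n \<Rightarrow> complex" where
  "val0 f = (\<lambda>i. fcoef (\<lambda>t. f t i) 0)"

definition bshift :: "(real \<Rightarrow> 'n::finite \<Rightarrow> complex) \<Rightarrow> real \<Rightarrow> 'n \<Rightarrow> complex" where
  "bshift f = (\<lambda>t i. (f t i - val0 f i) * exp (- \<i> * of_real t))"

end

theory Submission
  imports Defs
begin

text \<open>
  For \<open>f\<close> in the domain with \<open>f(0) = 0\<close> and \<open>w\<close> in the model space,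
  \<open>\<langle>G S\<^sup>*f, w\<rangle> = \<langle>G f, z w\<rangle>\<close>. Since \<open>z w\<close> is orthogonal to \<open>z \<Theta> H\<^sup>2\<close>, it differs from an element of
  the model space by \<open>\<Theta> c\<close> with \<open>c\<close> a constant vector. Hence \<open>P(G S\<^sup>*f)\<close> equals \<open>S\<^sup>*P(G f)\<close> plus
  a combination of the \<open>n\<close> functions \<open>S\<^sup>*(\<Theta> e\<^sub>j)\<close>, whose coefficients \<open>\<langle>G f, \<Theta> e\<^sub>j\<rangle> / 2\<pi>\<close> are
  continuous in \<open>f\<close> because \<open>G\<^sup>*\<Theta> e\<^sub>j\<close> is square integrable. So if \<open>f\<close> lies in the kernel,
  \<open>f(0) = 0\<close> and the \<open>n\<close> coefficients of \<open>f\<close> vanish, then \<open>S\<^sup>*f\<close> lies in the kernel; these are \<open>n\<close>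
  linear conditions, and the defect space is spanned by at most \<open>n\<close> backward shifts violating them.
\<close>

text \<open>The kernel lives in L^2, but the symbol acts on bounded functions: for general
  \<open>f\<close> the product \<open>mvmult G f\<close> need not be square integrable. The identity
  for backward shifts is therefore established on \<open>mtto_dom\<close> and carried over by
  limits, which brings three obstacles. Approximants of a function vanishing at 0 need not vanish
  there. The kernel is defined through all approximating sequences, and boundedness is what reduces
  this to the existence of one. Elements that no sequence of the domain reaches form a separate
  case. The Hardy space input is that a bounded analytic function times an H^2 function is again in
  H^2; as \<open>Hp_circ\<close> is defined by Fourier coefficients, this is drawn from the L^2
  density of trigonometric polynomials. The factors 2 pi arise because \<open>vinner\<close>
  integrates against unnormalised Lebesgue measure while \<open>fcoef\<close> is normalised.\<close>

subsection \<open>Square integrable functions on the circle\<close>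

\<comment> \<open>As a simp rule it would rewrite the exponent of \<open>Lp_circ 2\<close> to \<open>ereal 2\<close>.\<close>
declare numeral_eq_ereal [simp del]

lemma space_circ [simp]: "space circ = {0..2*pi}"
  by (simp add: circ_def)

lemma finite_measure_circ: "finite_measure circ"
  by (simp add: circ_def finite_measure_lebesgue_on)

lemma continuous_measurable_circ: "continuous_on UNIV f \<Longrightarrow> f \<in> borel_measurable circ"
  unfolding circ_def
  by (intro continuous_imp_measurable_on_sets_lebesgue) (auto intro: continuous_on_subset)

lemma exp_measurable_circ [measurable]:
  "(\<lambda>t::real. exp (\<i> * of_real t)) \<in> borel_measurable circ"
  "(\<lambda>t::real. exp (- \<i> * of_real t)) \<in> borel_measurable circ"
  "(\<lambda>t::real. exp (\<i> * of_int k * of_real t)) \<in> borel_measurable circ"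
  "(\<lambda>t::real. exp (- \<i> * of_int k * of_real t)) \<in> borel_measurable circ"
  by (intro continuous_measurable_circ continuous_intros)+

lemma norm_exp_circ [simp]:
  "cmod (exp (\<i> * of_real t)) = 1" "cmod (exp (- \<i> * of_real t)) = 1"
  "cmod (exp (\<i> * of_int k * of_real t)) = 1" "cmod (exp (- \<i> * of_int k * of_real t)) = 1"
  by simp_all

lemma Lp_circ_2_iff:
  "Lp_circ 2 f \<longleftrightarrow> f \<in> borel_measurable circ \<and> integrable circ (\<lambda>t. (cmod (f t))\<^sup>2)"
proof -
  have "real_of_ereal 2 = 2" "(2::ereal) \<noteq> \<infinity>"
    by (simp_all add: numeral_eq_ereal)
  then show ?thesis
    by (simp add: Lp_circ_def)
qed

text \<open>The bound can be taken nonnegative, which is what monotonicity of products and squares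
  asks for in the estimates below.\<close>

lemma Lp_circ_infinity_iff:
  "Lp_circ \<infinity> f \<longleftrightarrow> f \<in> borel_measurable circ \<and> (\<exists>C\<ge>0. AE t in circ. cmod (f t) \<le> C)"
proof -
  have "\<exists>C\<ge>0. AE t in circ. cmod (f t) \<le> C" if "AE t in circ. cmod (f t) \<le> C" for C
    using that by (intro exI[of _ "max C 0"]) (auto elim: eventually_mono)
  then show ?thesis
    by (auto simp: Lp_circ_def)
qed

lemma Lp_circ_infinity_mult:
  assumes "Lp_circ \<infinity> f" "Lp_circ \<infinity> g"
  shows "Lp_circ \<infinity> (\<lambda>t. f t * g t)"
proof -
  obtain C D where "C \<ge> 0" "AE t in circ. cmod (f t) \<le> C" "D \<ge> 0" "AE t in circ. cmod (g t) \<le> D"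
    using assms by (auto simp: Lp_circ_infinity_iff)
  then have "AE t in circ. cmod (f t * g t) \<le> C * D"
    by (auto simp: norm_mult elim!: eventually_elim2 intro!: mult_mono)
  then show ?thesis
    using assms by (auto simp: Lp_circ_def)
qed

lemma Lp_circ_infinity_add:
  assumes "Lp_circ \<infinity> f" "Lp_circ \<infinity> g"
  shows "Lp_circ \<infinity> (\<lambda>t. f t + g t)"
proof -
  obtain C D where "AE t in circ. cmod (f t) \<le> C" "AE t in circ. cmod (g t) \<le> D"
    using assms by (auto simp: Lp_circ_infinity_iff)
  then have "AE t in circ. cmod (f t + g t) \<le> C + D"
    by eventually_elim (meson add_mono norm_triangle_ineq order_trans)
  then show ?thesis
    using assms by (auto simp: Lp_circ_def)
qed

lemma Lp_circ_infinity_const: "Lp_circ \<infinity> (\<lambda>t. c)"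
  by (auto simp: Lp_circ_def intro!: exI[of _ "cmod c"])

lemma Lp_circ_infinity_unimodular:
  "f \<in> borel_measurable circ \<Longrightarrow> (\<And>t. cmod (f t) = 1) \<Longrightarrow> Lp_circ \<infinity> f"
  by (auto simp: Lp_circ_def intro!: exI[of _ "1::real"])

lemma Lp_circ_infinity_exp:
  "Lp_circ \<infinity> (\<lambda>t. exp (\<i> * of_real t))" "Lp_circ \<infinity> (\<lambda>t. exp (- \<i> * of_real t))"
  "Lp_circ \<infinity> (\<lambda>t. exp (\<i> * of_int k * of_real t))"
  "Lp_circ \<infinity> (\<lambda>t. exp (- \<i> * of_int k * of_real t))"
  by (intro Lp_circ_infinity_unimodular exp_measurable_circ norm_exp_circ)+

lemma Lp_circ_2_cnj: "Lp_circ 2 f \<Longrightarrow> Lp_circ 2 (\<lambda>t. cnj (f t))"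
  by (auto simp: Lp_circ_2_iff intro: borel_measurable_continuous_on[OF continuous_on_cnj] continuous_on_id)

lemma cmod_add_squared_le: "(cmod (a + b))\<^sup>2 \<le> 2 * (cmod a)\<^sup>2 + 2 * (cmod b)\<^sup>2"
proof -
  have "(cmod (a + b))\<^sup>2 \<le> (cmod a + cmod b)\<^sup>2"
    by (intro power_mono norm_triangle_ineq) auto
  also have "\<dots> \<le> 2 * (cmod a)\<^sup>2 + 2 * (cmod b)\<^sup>2"
    using sum_squares_bound[of "cmod a" "cmod b"] by (simp add: power2_sum)
  finally show ?thesis .
qed

lemma Lp_circ_2_add:
  assumes "Lp_circ 2 f" "Lp_circ 2 g"
  shows "Lp_circ 2 (\<lambda>t. f t + g t)"
proof -
  have [measurable]: "f \<in> borel_measurable circ" "g \<in> borel_measurable circ"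
    using assms by (auto simp: Lp_circ_2_iff)
  have "integrable circ (\<lambda>t. 2 * (cmod (f t))\<^sup>2 + 2 * (cmod (g t))\<^sup>2)"
    using assms by (auto simp: Lp_circ_2_iff)
  then have "integrable circ (\<lambda>t. (cmod (f t + g t))\<^sup>2)"
    by (rule Bochner_Integration.integrable_bound) (auto simp: cmod_add_squared_le)
  then show ?thesis
    by (simp add: Lp_circ_2_iff)
qed

lemma Lp_circ_2_bounded_mult:
  assumes "Lp_circ \<infinity> g" "Lp_circ 2 f"
  shows "Lp_circ 2 (\<lambda>t. g t * f t)"
proof -
  have [measurable]: "f \<in> borel_measurable circ" "g \<in> borel_measurable circ"
    using assms by (auto simp: Lp_circ_def)
  obtain C where "C \<ge> 0" and C: "AE t in circ. cmod (g t) \<le> C"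
    using assms by (auto simp: Lp_circ_infinity_iff)
  have "integrable circ (\<lambda>t. C\<^sup>2 * (cmod (f t))\<^sup>2)"
    using assms by (auto simp: Lp_circ_2_iff)
  then have "integrable circ (\<lambda>t. (cmod (g t * f t))\<^sup>2)"
  proof (rule Bochner_Integration.integrable_bound)
    show "AE t in circ. norm ((cmod (g t * f t))\<^sup>2) \<le> norm (C\<^sup>2 * (cmod (f t))\<^sup>2)"
      using C \<open>C \<ge> 0\<close> by (auto simp: norm_mult power_mult_distrib elim!: eventually_mono
          intro!: mult_mono power_mono)
  qed measurable
  then show ?thesis
    by (simp add: Lp_circ_2_iff)
qed

lemma Lp_circ_2_const: "Lp_circ 2 (\<lambda>t. c)"
  using finite_measure_circ by (auto simp: Lp_circ_2_iff intro: finite_measure.integrable_const)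

lemma Lp_circ_2_cmult: "Lp_circ 2 f \<Longrightarrow> Lp_circ 2 (\<lambda>t. c * f t)"
  using Lp_circ_2_bounded_mult Lp_circ_infinity_const by blast

lemma Lp_circ_2_diff:
  assumes "Lp_circ 2 f" "Lp_circ 2 g"
  shows "Lp_circ 2 (\<lambda>t. f t - g t)"
  using Lp_circ_2_add[OF assms(1) Lp_circ_2_cmult[OF assms(2), of "-1"]] by simp

lemma Lp_circ_2_sum:
  assumes "\<And>j. j \<in> A \<Longrightarrow> Lp_circ 2 (f j)"
  shows "Lp_circ 2 (\<lambda>t. \<Sum>j\<in>A. f j t)"
  using assms
  by (induction A rule: infinite_finite_induct) (auto intro: Lp_circ_2_add Lp_circ_2_const)

lemma Lp_circ_infinity_imp_2:
  assumes "Lp_circ \<infinity> f"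
  shows "Lp_circ 2 f"
  using Lp_circ_2_bounded_mult[OF assms Lp_circ_2_const[of 1]] by simp

text \<open>The circle has finite measure, so a constant plus \<open>cmod z powr q\<close> is an
  integrable majorant: the square is at most 1 on the unit disc and at most
  \<open>cmod z powr q\<close> outside it.\<close>

lemma Lp_circ_imp_2:
  assumes "2 < p" "Lp_circ p f"
  shows "Lp_circ 2 f"
proof (cases "p = \<infinity>")
  case True
  then show ?thesis using assms Lp_circ_infinity_imp_2 by blast
next
  case False
  with \<open>2 < p\<close> obtain q where q: "p = ereal q"
    by (cases p) auto
  with \<open>2 < p\<close> have "2 < q"
    by (metis less_ereal.simps(1) numeral_eq_ereal)
  have [measurable]: "f \<in> borel_measurable circ"
    using assms by (auto simp: Lp_circ_def)
  have "integrable circ (\<lambda>t. 1 + norm (f t) powr q)"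
    using assms q finite_measure_circ
    by (auto simp: Lp_circ_def intro!: Bochner_Integration.integrable_add finite_measure.integrable_const)
  then have "integrable circ (\<lambda>t. (cmod (f t))\<^sup>2)"
  proof (rule Bochner_Integration.integrable_bound)
    have "(cmod z)\<^sup>2 \<le> 1 + cmod z powr q" for z
    proof (cases "cmod z \<le> 1")
      case True
      then have "(cmod z)\<^sup>2 \<le> 1"
        by (simp add: power_le_one)
      then show ?thesis
        by (simp add: add_increasing2)
    next
      case False
      then have "cmod z powr 2 \<le> cmod z powr q"
        using \<open>2 < q\<close> by (intro powr_mono) auto
      then show ?thesis by simp
    qed
    then show "AE t in circ. norm ((cmod (f t))\<^sup>2) \<le> norm (1 + cmod (f t) powr q)"
      by simp
  qed measurable
  then show ?thesis
    by (simp add: Lp_circ_2_iff)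
qed

lemma Lp_circ_2_mult_integrable:
  assumes "Lp_circ 2 f" "Lp_circ 2 g"
  shows "integrable circ (\<lambda>t. f t * g t)"
proof -
  have [measurable]: "f \<in> borel_measurable circ" "g \<in> borel_measurable circ"
    using assms by (auto simp: Lp_circ_def)
  have "integrable circ (\<lambda>t. (cmod (f t))\<^sup>2 + (cmod (g t))\<^sup>2)"
    using assms by (auto simp: Lp_circ_2_iff)
  then show ?thesis
  proof (rule Bochner_Integration.integrable_bound)
    have "cmod a * cmod b \<le> (cmod a)\<^sup>2 + (cmod b)\<^sup>2" for a b
      using sum_squares_bound[of "cmod a" "cmod b"] mult_nonneg_nonneg[of "cmod a" "cmod b", OF norm_ge_zero norm_ge_zero]
      by linarith
    then show "AE t in circ. norm (f t * g t) \<le> norm ((cmod (f t))\<^sup>2 + (cmod (g t))\<^sup>2)"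
      by (simp add: norm_mult)
  qed measurable
qed

lemma Lp_circ_2_integrable: "Lp_circ 2 f \<Longrightarrow> integrable circ f"
  using Lp_circ_2_mult_integrable[OF Lp_circ_2_const[of 1]] by simp

text \<open>Orthogonality of the characters: for \<open>k \<noteq> 0\<close> the antiderivative
  \<open>?F\<close> takes equal values at the two endpoints.\<close>

lemma integral_exp_circ:
  "(\<integral>t. exp (\<i> * of_int k * of_real t) \<partial>circ) = (if k = 0 then 2 * pi else 0)"
proof -
  have "integrable circ (\<lambda>t. exp (\<i> * of_int k * of_real t))"
    by (intro Lp_circ_2_integrable Lp_circ_infinity_imp_2 Lp_circ_infinity_exp)
  then have *: "(\<integral>t. exp (\<i> * of_int k * of_real t) \<partial>circ) =
      integral {0..2*pi} (\<lambda>t. exp (\<i> * of_int k * of_real t))"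
    unfolding circ_def by (intro lebesgue_integral_eq_integral) auto
  show ?thesis
  proof (cases "k = 0")
    case True
    then show ?thesis
      unfolding * by (simp add: scaleR_conv_of_real)
  next
    case False
    let ?F = "\<lambda>t::real. exp (\<i> * of_int k * of_real t) / (\<i> * of_int k)"
    have "((\<lambda>t. exp (\<i> * of_int k * of_real t)) has_integral (?F (2*pi) - ?F 0)) {0..2*pi}"
    proof (rule fundamental_theorem_of_calculus)
      fix t :: real
      have "((\<lambda>z. exp (\<i> * of_int k * z) / (\<i> * of_int k)) has_field_derivative
              exp (\<i> * of_int k * of_real t)) (at (of_real t) within of_real ` {0..2*pi})"
        using False by (auto intro!: derivative_eq_intros)
      then show "(?F has_vector_derivative exp (\<i> * of_int k * of_real t)) (at t within {0..2*pi})"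
        using field_vector_diff_chain_within[of complex_of_real 1 t "{0..2*pi}"]
          has_vector_derivative_of_real[OF DERIV_ident]
        by (auto simp: o_def has_real_derivative_iff_has_vector_derivative)
    qed simp
    moreover have "exp (\<i> * of_int k * of_real (2 * pi)) = 1"
      using exp_integer_2pi[of "of_int k"] by (simp add: mult_ac)
    ultimately show ?thesis
      unfolding * using False by (simp add: integral_unique)
  qed
qed

subsection \<open>Density of trigonometric polynomials\<close>

text \<open>The set \<open>S\<close> records the allowed frequencies, so that analytic polynomials
  (\<open>S = {0..}\<close>) and strictly antianalytic ones (\<open>S = {..<0}\<close>) are
  instances of one notion; induction over sums replaces families of coefficients.\<close>

inductive trig_poly :: "int set \<Rightarrow> (real \<Rightarrow> complex) \<Rightarrow> bool" for S where
  monomial: "k \<in> S \<Longrightarrow> trig_poly S (\<lambda>t. c * exp (\<i> * of_int k * of_real t))"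
| add: "trig_poly S f \<Longrightarrow> trig_poly S g \<Longrightarrow> trig_poly S (\<lambda>t. f t + g t)"

lemma trig_poly_cmult:
  assumes "trig_poly S f"
  shows "trig_poly S (\<lambda>t. c * f t)"
  using assms
proof induction
  case (monomial k d)
  then show ?case
    using trig_poly.monomial[of k S "c * d"] by (simp add: mult.assoc)
next
  case (add f g)
  then show ?case
    using trig_poly.add[OF add.IH] by (simp add: distrib_left)
qed

lemma trig_poly_const: "trig_poly UNIV (\<lambda>t. c)"
  using trig_poly.monomial[of 0 UNIV c] by simp

lemma trig_poly_mult:
  assumes "trig_poly UNIV f" "trig_poly UNIV g"
  shows "trig_poly UNIV (\<lambda>t. f t * g t)"
  using assms
proof (induction f rule: trig_poly.induct)
  case (monomial k c)
  from monomial.prems show ?case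
  proof (induction rule: trig_poly.induct)
    case (monomial l d)
    have "(\<lambda>t. c * exp (\<i> * of_int k * of_real t) * (d * exp (\<i> * of_int l * of_real t))) =
          (\<lambda>t. (c * d) * exp (\<i> * of_int (k + l) * of_real t))"
      by (simp add: fun_eq_iff algebra_simps exp_add)
    then show ?case
      by (simp only: trig_poly.monomial UNIV_I)
  next
    case (add g h)
    then show ?case
      using trig_poly.add[OF add.IH] by (simp add: distrib_left)
  qed
next
  case (add f h)
  then show ?case
    using trig_poly.add[OF add.IH(1)[OF add.prems] add.IH(2)[OF add.prems]]
    by (simp add: distrib_right)
qed

lemma trig_poly_Lp_infinity:
  assumes "trig_poly S f"
  shows "Lp_circ \<infinity> f"
  using assms
  by induction (intro Lp_circ_infinity_mult Lp_circ_infinity_const Lp_circ_infinity_exp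
      Lp_circ_infinity_add; assumption)+

lemma trig_poly_Lp_2: "trig_poly S f \<Longrightarrow> Lp_circ 2 f"
  using Lp_circ_infinity_imp_2 trig_poly_Lp_infinity by blast

lemma trig_poly_split:
  assumes "trig_poly UNIV q"
  shows "\<exists>q1 q2. trig_poly {0..} q1 \<and> trig_poly {..<0} q2 \<and> q = (\<lambda>t. q1 t + q2 t)"
  using assms
proof induction
  case (monomial k c)
  have 0: "trig_poly {0..} (\<lambda>t. 0)" "trig_poly {..<0} (\<lambda>t. 0)"
    using trig_poly.monomial[of 0 "{0..}" 0] trig_poly.monomial[of "-1" "{..<0}" 0] by auto
  show ?case
  proof (cases "k \<ge> 0")
    case True
    then show ?thesis
      using trig_poly.monomial[of k "{0..}" c] 0(2) by (intro exI conjI) auto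
  next
    case False
    then show ?thesis
      using trig_poly.monomial[of k "{..<0}" c] 0(1)
      by (intro exI[of _ "\<lambda>t. 0"] exI conjI) auto
  qed
next
  case (add f g)
  then obtain f1 f2 g1 g2 where
    "trig_poly {0..} f1" "trig_poly {..<0} f2" "f = (\<lambda>t. f1 t + f2 t)"
    "trig_poly {0..} g1" "trig_poly {..<0} g2" "g = (\<lambda>t. g1 t + g2 t)"
    by blast
  then show ?case
    using trig_poly.add[of "{0..}" f1 g1] trig_poly.add[of "{..<0}" f2 g2]
    by (intro exI[of _ "\<lambda>t. f1 t + g1 t"] exI[of _ "\<lambda>t. f2 t + g2 t"] conjI)
      (auto simp: algebra_simps)
qed

lemma integral_trig_poly_eq_0:
  assumes "trig_poly S q" "Lp_circ 2 g"
    and "\<And>k. k \<in> S \<Longrightarrow> (\<integral>t. g t * exp (\<i> * of_int k * of_real t) \<partial>circ) = 0"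
  shows "(\<integral>t. g t * q t \<partial>circ) = 0"
  using assms(1)
proof induction
  case (monomial k c)
  have "(\<lambda>t. g t * (c * exp (\<i> * of_int k * of_real t))) =
        (\<lambda>t. c * (g t * exp (\<i> * of_int k * of_real t)))"
    by (simp add: fun_eq_iff)
  then show ?case
    using assms(3)[OF monomial] by simp
next
  case (add f h)
  have "integrable circ (\<lambda>t. g t * f t)" "integrable circ (\<lambda>t. g t * h t)"
    using add assms(2) by (auto intro: Lp_circ_2_mult_integrable trig_poly_Lp_2)
  with add show ?case
    by (simp add: distrib_left)
qed

lemma real_polynomial_function_trig_poly:
  assumes "real_polynomial_function r"
  shows "trig_poly UNIV (\<lambda>t. of_real (r (exp (\<i> * of_real t))))"
  using assms
proof induction
  case (linear r)
  \<comment> \<open>A real-linear functional on the plane is determined by its values at 1 and at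
    the imaginary unit.\<close>
  have lin: "r z = Re z * r 1 + Im z * r \<i>" for z
  proof -
    have "r z = r (Re z *\<^sub>R 1 + Im z *\<^sub>R \<i>)"
      by (rule arg_cong[of _ _ r]) (simp add: complex_eq_iff)
    also have "\<dots> = Re z * r 1 + Im z * r \<i>"
      using linear by (simp only: bounded_linear.linear linear_add linear_scale real_scaleR_def)
    finally show ?thesis .
  qed
  \<comment> \<open>On the circle Re z and Im z are cos t and sin t, hence combinations of the
    frequencies 1 and -1.\<close>
  have "of_real (r (exp (\<i> * of_real t))) =
      (of_real (r 1) / 2 - \<i> * of_real (r \<i>) / 2) * exp (\<i> * of_int 1 * of_real t)
      + (of_real (r 1) / 2 + \<i> * of_real (r \<i>) / 2) * exp (\<i> * of_int (-1) * of_real t)" for t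
    by (subst lin) (auto simp: complex_eq_iff Re_exp Im_exp algebra_simps)
  then show ?case
    using trig_poly.add[OF trig_poly.monomial[of 1 UNIV] trig_poly.monomial[of "-1" UNIV]]
    by simp
next
  case (const c)
  then show ?case by (rule trig_poly_const)
next
  case (add f g)
  then show ?case using trig_poly.add by fastforce
next
  case (mult f g)
  then show ?case using trig_poly_mult by fastforce
qed

text \<open>Membership in the L^2 closure of the trigonometric polynomials. Distances are squared
  throughout, which avoids square roots and Minkowski's inequality.\<close>

definition trig_approx :: "(real \<Rightarrow> complex) \<Rightarrow> bool" where
  "trig_approx f \<longleftrightarrow> Lp_circ 2 f \<and>
     (\<forall>\<epsilon>>0. \<exists>q. trig_poly UNIV q \<and> (\<integral>t. (cmod (f t - q t))\<^sup>2 \<partial>circ) < \<epsilon>)"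

text \<open>A substitute for the triangle inequality on squared distances. Its factor 2 is the
  reason for the tolerances \<open>\<epsilon> / 4\<close> in the closure properties that
  follow.\<close>

lemma integral_norm_square_triangle:
  assumes "Lp_circ 2 f" "Lp_circ 2 g"
  shows "(\<integral>t. (cmod (f t + g t))\<^sup>2 \<partial>circ) \<le>
     2 * (\<integral>t. (cmod (f t))\<^sup>2 \<partial>circ) + 2 * (\<integral>t. (cmod (g t))\<^sup>2 \<partial>circ)"
proof -
  have "(\<integral>t. (cmod (f t + g t))\<^sup>2 \<partial>circ) \<le>
      (\<integral>t. 2 * (cmod (f t))\<^sup>2 + 2 * (cmod (g t))\<^sup>2 \<partial>circ)"
    using assms Lp_circ_2_add[OF assms]
    by (intro integral_mono) (auto simp: Lp_circ_2_iff cmod_add_squared_le)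
  also have "\<dots> = 2 * (\<integral>t. (cmod (f t))\<^sup>2 \<partial>circ) + 2 * (\<integral>t. (cmod (g t))\<^sup>2 \<partial>circ)"
    using assms by (simp add: Lp_circ_2_iff)
  finally show ?thesis .
qed

lemma trig_approx_limit:
  assumes "Lp_circ 2 f"
    and "\<And>\<epsilon>. \<epsilon> > 0 \<Longrightarrow> \<exists>g. trig_approx g \<and> (\<integral>t. (cmod (f t - g t))\<^sup>2 \<partial>circ) < \<epsilon>"
  shows "trig_approx f"
  unfolding trig_approx_def
proof (intro conjI allI impI assms(1))
  fix \<epsilon> :: real
  assume "\<epsilon> > 0"
  then obtain g where g: "trig_approx g" "(\<integral>t. (cmod (f t - g t))\<^sup>2 \<partial>circ) < \<epsilon> / 4"
    using assms(2)[of "\<epsilon> / 4"] by auto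
  with \<open>\<epsilon> > 0\<close> obtain q where q: "trig_poly UNIV q" "(\<integral>t. (cmod (g t - q t))\<^sup>2 \<partial>circ) < \<epsilon> / 4"
    unfolding trig_approx_def by (meson divide_pos_pos zero_less_numeral)
  have "(\<integral>t. (cmod (f t - q t))\<^sup>2 \<partial>circ) < \<epsilon>"
    using integral_norm_square_triangle[of "\<lambda>t. f t - g t" "\<lambda>t. g t - q t"] g q assms(1)
    by (auto simp: trig_approx_def Lp_circ_2_diff trig_poly_Lp_2)
  with q show "\<exists>q. trig_poly UNIV q \<and> (\<integral>t. (cmod (f t - q t))\<^sup>2 \<partial>circ) < \<epsilon>"
    by blast
qed

lemma trig_approx_add:
  assumes "trig_approx f" "trig_approx g"
  shows "trig_approx (\<lambda>t. f t + g t)"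
  unfolding trig_approx_def
proof (intro conjI allI impI)
  show "Lp_circ 2 (\<lambda>t. f t + g t)"
    using assms by (auto simp: trig_approx_def Lp_circ_2_add)
  fix \<epsilon> :: real
  assume "\<epsilon> > 0"
  then have "\<epsilon> / 4 > 0"
    by simp
  then obtain q r where q: "trig_poly UNIV q" "(\<integral>t. (cmod (f t - q t))\<^sup>2 \<partial>circ) < \<epsilon> / 4"
    and r: "trig_poly UNIV r" "(\<integral>t. (cmod (g t - r t))\<^sup>2 \<partial>circ) < \<epsilon> / 4"
    using assms unfolding trig_approx_def by meson
  have "(\<integral>t. (cmod (f t + g t - (q t + r t)))\<^sup>2 \<partial>circ) < \<epsilon>"
    using integral_norm_square_triangle[of "\<lambda>t. f t - q t" "\<lambda>t. g t - r t"] q r assms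
    by (auto simp: trig_approx_def Lp_circ_2_diff trig_poly_Lp_2 algebra_simps)
  with q r show "\<exists>q. trig_poly UNIV q \<and> (\<integral>t. (cmod (f t + g t - q t))\<^sup>2 \<partial>circ) < \<epsilon>"
    using trig_poly.add by blast
qed

lemma trig_approx_cmult:
  assumes "trig_approx f"
  shows "trig_approx (\<lambda>t. c * f t)"
  unfolding trig_approx_def
proof (intro conjI allI impI)
  show "Lp_circ 2 (\<lambda>t. c * f t)"
    using assms by (auto simp: trig_approx_def Lp_circ_2_cmult)
  fix \<epsilon> :: real
  assume "\<epsilon> > 0"
  \<comment> \<open>The summand 1 keeps the denominator positive when \<open>c = 0\<close>.\<close>
  define \<delta> where "\<delta> = \<epsilon> / ((cmod c)\<^sup>2 + 1)"
  have pos: "(cmod c)\<^sup>2 + 1 > 0"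
    by (simp add: add_nonneg_pos)
  then have "\<delta> > 0"
    using \<open>\<epsilon> > 0\<close> by (simp add: \<delta>_def)
  then obtain q where q: "trig_poly UNIV q" "(\<integral>t. (cmod (f t - q t))\<^sup>2 \<partial>circ) < \<delta>"
    using assms unfolding trig_approx_def by meson
  have "(\<integral>t. (cmod (c * f t - c * q t))\<^sup>2 \<partial>circ) = (cmod c)\<^sup>2 * (\<integral>t. (cmod (f t - q t))\<^sup>2 \<partial>circ)"
    by (simp add: norm_mult power_mult_distrib flip: right_diff_distrib)
  also have "\<dots> \<le> (cmod c)\<^sup>2 * \<delta>"
    using q by (intro mult_left_mono) auto
  also have "\<dots> < ((cmod c)\<^sup>2 + 1) * \<delta>"
    using \<open>\<delta> > 0\<close> by simp
  also have "\<dots> = \<epsilon>"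
    using pos by (simp add: \<delta>_def)
  finally show "\<exists>q. trig_poly UNIV q \<and> (\<integral>t. (cmod (c * f t - q t))\<^sup>2 \<partial>circ) < \<epsilon>"
    using q trig_poly_cmult by blast
qed

lemma trig_approx_sum:
  assumes "\<And>j. j \<in> A \<Longrightarrow> trig_approx (f j)"
  shows "trig_approx (\<lambda>t. \<Sum>j\<in>A. f j t)"
proof -
  have "trig_approx (\<lambda>t. 0)"
    unfolding trig_approx_def
    using Lp_circ_2_const trig_poly_const[of 0] by auto
  then show ?thesis
    using assms by (induction A rule: infinite_finite_induct) (auto intro: trig_approx_add)
qed

section \<open>From continuous functions to all of L^2\<close>

lemma trig_approx_continuous:
  fixes \<phi> :: "complex \<Rightarrow> complex"
  assumes "continuous_on UNIV \<phi>"
  shows "trig_approx (\<lambda>t. \<phi> (exp (\<i> * of_real t)))"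
  unfolding trig_approx_def
proof (intro conjI allI impI)
  have meas: "(\<lambda>t. \<phi> (exp (\<i> * of_real t))) \<in> borel_measurable circ"
    by (intro continuous_measurable_circ continuous_on_compose2[OF assms] continuous_intros) auto
  have "compact (\<phi> ` sphere 0 1)"
    by (intro compact_continuous_image continuous_on_subset[OF assms]) auto
  then obtain C where C: "cmod (\<phi> z) \<le> C" if "z \<in> sphere 0 1" for z
    by (metis compact_imp_bounded bounded_iff imageI)
  have "Lp_circ \<infinity> (\<lambda>t. \<phi> (exp (\<i> * of_real t)))"
    using meas C by (auto simp: Lp_circ_def intro!: exI[of _ C])
  then show L2: "Lp_circ 2 (\<lambda>t. \<phi> (exp (\<i> * of_real t)))"
    by (rule Lp_circ_infinity_imp_2)
  fix \<epsilon> :: real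
  assume "\<epsilon> > 0"
  \<comment> \<open>A uniform error \<open>\<delta>\<close> costs at most
    \<open>2 * pi * \<delta>\<^sup>2 = \<epsilon> / 2\<close> after integration over the
    circle.\<close>
  define \<delta> where "\<delta> = sqrt (\<epsilon> / (2 * (2 * pi)))"
  have "\<delta> > 0"
    using \<open>\<epsilon> > 0\<close> by (simp add: \<delta>_def)
  moreover have "continuous_on (sphere 0 1) \<phi>"
    using assms continuous_on_subset by blast
  \<comment> \<open>Stone-Weierstrass on the compact circle gives a polynomial in Re z and Im z,
    whose restriction to the circle is a trigonometric polynomial.\<close>
  ultimately obtain p where p: "polynomial_function p"
      "\<And>z. z \<in> sphere 0 1 \<Longrightarrow> cmod (\<phi> z - p z) < \<delta>"
    using Stone_Weierstrass_polynomial_function[of "sphere (0::complex) 1" \<phi> \<delta>] by auto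
  have "real_polynomial_function (Re \<circ> p)" "real_polynomial_function (Im \<circ> p)"
    using p(1) bounded_linear_Re bounded_linear_Im unfolding polynomial_function_def by auto
  then have "trig_poly UNIV (\<lambda>t. of_real ((Re \<circ> p) (exp (\<i> * of_real t)))
      + \<i> * of_real ((Im \<circ> p) (exp (\<i> * of_real t))))"
    by (intro trig_poly.add trig_poly_cmult real_polynomial_function_trig_poly)
  moreover have "of_real ((Re \<circ> p) z) + \<i> * of_real ((Im \<circ> p) z) = p z" for z
    by (simp add: complex_eq_iff)
  ultimately have q: "trig_poly UNIV (\<lambda>t. p (exp (\<i> * of_real t)))"
    by simp
  have "(\<integral>t. (cmod (\<phi> (exp (\<i> * of_real t)) - p (exp (\<i> * of_real t))))\<^sup>2 \<partial>circ)
      \<le> (\<integral>t. \<delta>\<^sup>2 \<partial>circ)"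
  proof (rule integral_mono)
    show "integrable circ (\<lambda>t. (cmod (\<phi> (exp (\<i> * of_real t)) - p (exp (\<i> * of_real t))))\<^sup>2)"
      using Lp_circ_2_diff[OF L2 trig_poly_Lp_2[OF q]] by (simp add: Lp_circ_2_iff)
    show "integrable circ (\<lambda>t. \<delta>\<^sup>2)"
      using finite_measure_circ by (intro finite_measure.integrable_const)
    fix t
    show "(cmod (\<phi> (exp (\<i> * of_real t)) - p (exp (\<i> * of_real t))))\<^sup>2 \<le> \<delta>\<^sup>2"
      using p(2)[of "exp (\<i> * of_real t)"] by (intro power_mono) auto
  qed
  also have "\<dots> = \<epsilon> / 2"
    using \<open>\<epsilon> > 0\<close> by (simp add: circ_def \<delta>_def measure_restrict_space)
  also have "\<dots> < \<epsilon>"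
    using \<open>\<epsilon> > 0\<close> by simp
  finally show "\<exists>q. trig_poly UNIV q \<and>
      (\<integral>t. (cmod (\<phi> (exp (\<i> * of_real t)) - q t))\<^sup>2 \<partial>circ) < \<epsilon>"
    using q by blast
qed

text \<open>The parameters 0 and 2 pi give the same point of the circle; away from them the
  parametrisation is injective.\<close>

lemma AE_circ_interior: "AE t in circ. 0 < t \<and> t < 2 * pi"
proof -
  have "AE t in lebesgue. t \<notin> {0, 2 * pi}"
    by (intro AE_not_in negligible_iff_null_sets[THEN iffD1] negligible_finite) auto
  then have "AE t in lebesgue. t \<in> {0..2*pi} \<longrightarrow> 0 < t \<and> t < 2 * pi"
    by eventually_elim auto
  then show ?thesis
    unfolding circ_def by (subst AE_restrict_space_iff) auto
qed

lemma Lp_circ_infinity_indicator: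
  "A \<in> sets circ \<Longrightarrow> Lp_circ \<infinity> (\<lambda>t. indicator A t :: complex)"
  by (auto simp: Lp_circ_def indicator_def intro!: exI[of _ "1::real"] measurable_If_set)

text \<open>The image \<open>E\<close> of \<open>T\<close> is compact, and tents of slope
  \<open>n\<close> in the distance to \<open>E\<close> are continuous on the plane and converge to
  the indicator of \<open>E\<close>. Inside the open interval the parametrisation is injective, so
  pulling back yields the indicator of \<open>T\<close> and not of a larger set.\<close>

lemma trig_approx_indicator_closed:
  assumes "closed T" "T \<subseteq> {0<..<2*pi}"
  shows "trig_approx (\<lambda>t. indicator T t)"
proof (cases "T = {}")
  case True
  then show ?thesis
    using trig_approx_sum[of "{}"] by simp
next
  case False
  define E where "E = (\<lambda>t. exp (\<i> * of_real t)) ` T"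
  have "compact T"
    using assms bounded_subset[of "{0..2*pi}" T] by (force simp: compact_eq_bounded_closed)
  then have "closed E"
    unfolding E_def by (intro compact_imp_closed compact_continuous_image continuous_intros)
  have "E \<noteq> {}"
    using False by (simp add: E_def)
  define \<phi> where "\<phi> n z = complex_of_real (max 0 (1 - real n * infdist z E))" for n z
  have cont: "continuous_on UNIV (\<phi> n)" for n
    unfolding \<phi>_def by (intro continuous_intros)
  have T: "T \<in> sets circ"
    using assms by (auto simp: circ_def sets_restrict_space_iff)
  have lim: "(\<lambda>n. \<phi> n (exp (\<i> * of_real t))) \<longlonglongrightarrow> indicator T t" if t: "0 < t" "t < 2 * pi" for t
  proof (cases "t \<in> T")
    case True
    then have "infdist (exp (\<i> * of_real t)) E = 0"
      by (intro infdist_zero) (auto simp: E_def)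
    then show ?thesis
      using True by (simp add: \<phi>_def)
  next
    case False
    have "exp (\<i> * of_real t) \<notin> E"
    proof
      assume "exp (\<i> * of_real t) \<in> E"
      then obtain s where s: "s \<in> T" "exp (\<i> * of_real t) = exp (\<i> * of_real s)"
        by (auto simp: E_def)
      have "0 < s \<and> s < 2 * pi"
        using s(1) assms(2) by auto
      then have "\<bar>Im (\<i> * of_real t) - Im (\<i> * of_real s)\<bar> < 2 * pi"
        using t by simp linarith
      from exp_complex_eqI[OF this s(2)] have "t = s"
        by simp
      with s(1) False show False
        by simp
    qed
    then have pos: "infdist (exp (\<i> * of_real t)) E > 0"
      using \<open>closed E\<close> \<open>E \<noteq> {}\<close> infdist_pos_not_in_closed by blast
    obtain N where "1 < real N * infdist (exp (\<i> * of_real t)) E"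
      using reals_Archimedean3[OF pos] by blast
    then have "\<phi> n (exp (\<i> * of_real t)) = indicator T t" if "n \<ge> N" for n
    proof -
      have "real N * infdist (exp (\<i> * of_real t)) E \<le> real n * infdist (exp (\<i> * of_real t)) E"
        using that pos by (intro mult_right_mono) auto
      with \<open>1 < _\<close> show ?thesis
        using False by (simp add: \<phi>_def)
    qed
    then show ?thesis
      by (intro tendsto_eventually) (auto simp: eventually_sequentially)
  qed
  have meas [measurable]: "(\<lambda>t. indicator T t :: complex) \<in> borel_measurable circ"
    "(\<lambda>t. \<phi> n (exp (\<i> * of_real t))) \<in> borel_measurable circ" for n
    using Lp_circ_infinity_indicator[OF T] trig_approx_continuous[OF cont]
    by (auto simp: trig_approx_def Lp_circ_def)
  have "(\<lambda>n. \<integral>t. (cmod (indicator T t - \<phi> n (exp (\<i> * of_real t))))\<^sup>2 \<partial>circ)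
      \<longlonglongrightarrow> (\<integral>t. 0 \<partial>circ)"
  proof (rule integral_dominated_convergence)
    show "integrable circ (\<lambda>t. 1::real)"
      using finite_measure_circ by (intro finite_measure.integrable_const)
    show "AE t in circ. (\<lambda>n. (cmod (indicator T t - \<phi> n (exp (\<i> * of_real t))))\<^sup>2) \<longlonglongrightarrow> 0"
      using AE_circ_interior
    proof eventually_elim
      case (elim t)
      then have "(\<lambda>n. (cmod (indicator T t - \<phi> n (exp (\<i> * of_real t))))\<^sup>2) \<longlonglongrightarrow>
          (cmod (indicator T t - indicator T t))\<^sup>2"
        by (intro tendsto_intros lim) auto
      then show ?case by simp
    qed
    have "(cmod (indicator T t - \<phi> n z))\<^sup>2 \<le> 1" for n t z
    proof -
      have "\<bar>indicator T t - max 0 (1 - real n * infdist z E)\<bar> \<le> 1"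
        using mult_nonneg_nonneg[OF of_nat_0_le_iff[of n] infdist_nonneg[of z E]]
        by (auto simp: indicator_def abs_if max_def)
      moreover have "indicator T t - \<phi> n z =
          complex_of_real (indicator T t - max 0 (1 - real n * infdist z E))"
        by (simp add: \<phi>_def indicator_def)
      ultimately show ?thesis
        by (simp only: norm_of_real) (metis abs_ge_zero power_le_one)
    qed
    then show "AE t in circ. norm ((cmod (indicator T t - \<phi> n (exp (\<i> * of_real t))))\<^sup>2) \<le> 1" for n
      by simp
  qed measurable
  then have *: "(\<lambda>n. \<integral>t. (cmod (indicator T t - \<phi> n (exp (\<i> * of_real t))))\<^sup>2 \<partial>circ) \<longlonglongrightarrow> 0"
    by simp
  show ?thesis
  proof (rule trig_approx_limit)
    show "Lp_circ 2 (\<lambda>t. indicator T t)"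
      by (intro Lp_circ_infinity_imp_2 Lp_circ_infinity_indicator T)
    fix \<epsilon> :: real
    assume "\<epsilon> > 0"
    then show "\<exists>g. trig_approx g \<and> (\<integral>t. (cmod (indicator T t - g t))\<^sup>2 \<partial>circ) < \<epsilon>"
      using order_tendstoD(2)[OF *, of \<epsilon>] trig_approx_continuous[OF cont]
      by (meson eventually_happens' sequentially_bot)
  qed
qed

text \<open>Inner regularity of Lebesgue measure: removing a set of measure less than
  \<open>\<epsilon>\<close> moves an indicator by a squared L^2 distance less than
  \<open>\<epsilon>\<close>.\<close>

lemma trig_approx_indicator:
  assumes A: "A \<in> sets circ"
  shows "trig_approx (\<lambda>t. indicator A t)"
proof (rule trig_approx_limit)
  show "Lp_circ 2 (\<lambda>t. indicator A t)"
    by (intro Lp_circ_infinity_imp_2 Lp_circ_infinity_indicator A)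
  fix \<epsilon> :: real
  assume "\<epsilon> > 0"
  \<comment> \<open>Removing the two endpoints changes nothing almost everywhere and puts every
    closed subset of \<open>B\<close> inside the open interval.\<close>
  define B where "B = A \<inter> {0<..<2*pi}"
  have A': "A \<in> sets lebesgue" "A \<subseteq> {0..2*pi}"
    using A by (auto simp: circ_def sets_restrict_space_iff)
  then have B: "B \<in> sets lebesgue"
    by (auto simp: B_def)
  then obtain T where T: "closed T" "T \<subseteq> B" "B - T \<in> lmeasurable"
      "emeasure lebesgue (B - T) < ennreal \<epsilon>"
    using sets_lebesgue_inner_closed \<open>\<epsilon> > 0\<close> by blast
  have BT: "B - T \<in> sets circ"
    using T B A'(2) by (auto simp: circ_def sets_restrict_space_iff B_def)
  have "(\<integral>t. (cmod (indicator A t - indicator T t))\<^sup>2 \<partial>circ) = (\<integral>t. indicator (B - T) t \<partial>circ)"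
  proof (rule integral_cong_AE)
    have TT: "T \<in> sets circ"
      using T A' by (auto simp: circ_def sets_restrict_space_iff B_def)
    show "(\<lambda>t. (cmod (indicator A t - indicator T t))\<^sup>2) \<in> borel_measurable circ"
      using Lp_circ_infinity_indicator[OF A] Lp_circ_infinity_indicator[OF TT]
      by (auto simp: Lp_circ_def)
    show "indicat_real (B - T) \<in> borel_measurable circ"
      using BT by simp
    show "AE t in circ. (cmod (indicator A t - indicator T t))\<^sup>2 = indicat_real (B - T) t"
      using AE_circ_interior by eventually_elim (use T in \<open>auto simp: B_def indicator_def\<close>)
  qed
  also have "\<dots> = measure circ (B - T)"
    using BT A'(2) by (simp add: B_def) (metis Int_absorb2 Diff_subset inf_le1 subset_trans)
  also have "\<dots> = measure lebesgue (B - T)"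
    using A'(2) unfolding circ_def by (subst measure_restrict_space) (auto simp: B_def)
  also have "\<dots> < \<epsilon>"
    using T(3,4) \<open>\<epsilon> > 0\<close> by (simp add: emeasure_eq_measure2 ennreal_less_iff)
  finally have "(\<integral>t. (cmod (indicator A t - indicator T t))\<^sup>2 \<partial>circ) < \<epsilon>" .
  moreover have "trig_approx (\<lambda>t. indicator T t)"
    using T by (intro trig_approx_indicator_closed) (auto simp: B_def)
  ultimately show "\<exists>g. trig_approx g \<and> (\<integral>t. (cmod (indicator A t - g t))\<^sup>2 \<partial>circ) < \<epsilon>"
    by blast
qed

lemma trig_approx_simple_function:
  fixes s :: "real \<Rightarrow> complex"
  assumes "simple_function circ s"
  shows "trig_approx s"
proof -
  let ?R = "s ` space circ"
  \<comment> \<open>\<open>r\<close> agrees with \<open>s\<close> on \<open>{0..2*pi}\<close>, but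
    as functions on the reals they may differ, so approximability is transferred through distance
    0.\<close>
  define r where "r = (\<lambda>t. \<Sum>y\<in>?R. y * indicator (s -` {y} \<inter> space circ) t)"
  have r: "trig_approx r"
    unfolding r_def using assms by (intro trig_approx_sum trig_approx_cmult trig_approx_indicator)
      (auto simp: simple_function_def)
  have fin: "finite ?R"
    using assms by (simp add: simple_function_def)
  have eq: "s t = r t" if "t \<in> space circ" for t
  proof -
    have "r t = (\<Sum>y\<in>?R. if y = s t then y else 0)"
      unfolding r_def using that by (intro sum.cong) (auto simp: indicator_def)
    also have "\<dots> = s t"
      using fin that by (simp add: sum.delta')
    finally show ?thesis ..
  qed
  have meas: "s \<in> borel_measurable circ"
    using assms borel_measurable_simple_function by blast
  have int: "integrable circ (\<lambda>t. (cmod (s t))\<^sup>2) \<longleftrightarrow> integrable circ (\<lambda>t. (cmod (r t))\<^sup>2)"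
    by (intro Bochner_Integration.integrable_cong refl) (simp only: eq)
  have dist: "(\<integral>t. (cmod (s t - r t))\<^sup>2 \<partial>circ) = 0"
    by (intro integral_eq_zero_AE AE_I2) (simp add: eq)
  show ?thesis
  proof (rule trig_approx_limit)
    show "Lp_circ 2 s"
      using r meas int by (simp add: trig_approx_def Lp_circ_2_iff)
    show "\<exists>g. trig_approx g \<and> (\<integral>t. (cmod (s t - g t))\<^sup>2 \<partial>circ) < \<epsilon>" if "\<epsilon> > 0" for \<epsilon>
      using that by (intro exI[of _ r] conjI r) (simp only: dist)
  qed
qed

lemma Lp_2_trig_approx:
  assumes "Lp_circ 2 f"
  shows "trig_approx f"
proof (rule trig_approx_limit[OF assms])
  fix \<epsilon> :: real
  assume "\<epsilon> > 0"
  have [measurable]: "f \<in> borel_measurable circ"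
    using assms by (simp add: Lp_circ_def)
  obtain s where s: "\<And>i. simple_function circ (s i)"
      "\<And>t. t \<in> space circ \<Longrightarrow> (\<lambda>i. s i t) \<longlonglongrightarrow> f t"
      "\<And>i t. t \<in> space circ \<Longrightarrow> norm (s i t) \<le> 2 * norm (f t)"
    using borel_measurable_implies_sequence_metric[of f circ 0] unfolding dist_0_norm dist_norm
    by (simp del: space_circ) blast
  have [measurable]: "s i \<in> borel_measurable circ" for i
    using s(1) borel_measurable_simple_function by blast
  have "(\<lambda>i. \<integral>t. (cmod (f t - s i t))\<^sup>2 \<partial>circ) \<longlonglongrightarrow> (\<integral>t. 0 \<partial>circ)"
  proof (rule integral_dominated_convergence)
    \<comment> \<open>The bound \<open>norm (s i t) \<le> 2 * norm (f t)\<close> makes the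
      difference at most three times \<open>norm (f t)\<close>; hence the factor 9.\<close>
    show "integrable circ (\<lambda>t. 9 * (cmod (f t))\<^sup>2)"
      using assms by (simp add: Lp_circ_2_iff)
    have "(\<lambda>i. (cmod (f t - s i t))\<^sup>2) \<longlonglongrightarrow> 0" if "t \<in> space circ" for t
    proof -
      have "(\<lambda>i. (cmod (f t - s i t))\<^sup>2) \<longlonglongrightarrow> (cmod (f t - f t))\<^sup>2"
        by (intro tendsto_intros s that)
      then show ?thesis by simp
    qed
    then show "AE t in circ. (\<lambda>i. (cmod (f t - s i t))\<^sup>2) \<longlonglongrightarrow> 0"
      by (intro AE_I2)
    have "(cmod (f t - s i t))\<^sup>2 \<le> 9 * (cmod (f t))\<^sup>2" if "t \<in> space circ" for i t
    proof -
      have "cmod (f t - s i t) \<le> 3 * cmod (f t)"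
        using norm_triangle_ineq4[of "f t" "s i t"] s(3)[OF that, of i] by linarith
      then have "(cmod (f t - s i t))\<^sup>2 \<le> (3 * cmod (f t))\<^sup>2"
        by (intro power_mono) auto
      then show ?thesis
        by (simp add: power_mult_distrib)
    qed
    then show "AE t in circ. norm ((cmod (f t - s i t))\<^sup>2) \<le> 9 * (cmod (f t))\<^sup>2" for i
      by (intro AE_I2) simp
  qed measurable
  then have "(\<lambda>i. \<integral>t. (cmod (f t - s i t))\<^sup>2 \<partial>circ) \<longlonglongrightarrow> 0"
    by simp
  from order_tendstoD(2)[OF this \<open>\<epsilon> > 0\<close>]
  show "\<exists>g. trig_approx g \<and> (\<integral>t. (cmod (f t - g t))\<^sup>2 \<partial>circ) < \<epsilon>"
    using trig_approx_simple_function[OF s(1)] by (meson eventually_happens' sequentially_bot)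
qed

subsection \<open>Products of Hardy space functions\<close>

text \<open>Takes the place of the Cauchy-Schwarz inequality: a weighted arithmetic-geometric mean
  bound is integrated, and the free weight \<open>s\<close> is tuned afterwards.\<close>

lemma norm_integral_mult_le:
  assumes "Lp_circ 2 f" "Lp_circ 2 g" "s > 0"
  shows "cmod (\<integral>t. f t * g t \<partial>circ) \<le>
    s * (\<integral>t. (cmod (f t))\<^sup>2 \<partial>circ) + (\<integral>t. (cmod (g t))\<^sup>2 \<partial>circ) / s"
proof -
  have am_gm: "a * b \<le> s * a\<^sup>2 + b\<^sup>2 / s" if "a \<ge> 0" "b \<ge> 0" for a b :: real
  proof -
    \<comment> \<open>Adding \<open>s * (a * b)\<close> turns the cross term
      \<open>- 2 * s * (a * b)\<close> of the square into \<open>- s * (a * b)\<close>.\<close>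
    have "0 \<le> (s * a - b)\<^sup>2 + s * (a * b)"
      using that \<open>s > 0\<close> by simp
    then have "s * (a * b) \<le> s * (s * a\<^sup>2 + b\<^sup>2 / s)"
      using \<open>s > 0\<close> by (simp add: power2_eq_square algebra_simps)
    then show ?thesis
      using \<open>s > 0\<close> by simp
  qed
  have "cmod (\<integral>t. f t * g t \<partial>circ) \<le> (\<integral>t. cmod (f t * g t) \<partial>circ)"
    by (rule integral_norm_bound)
  also have "\<dots> \<le> (\<integral>t. s * (cmod (f t))\<^sup>2 + (cmod (g t))\<^sup>2 / s \<partial>circ)"
  proof (rule integral_mono)
    show "integrable circ (\<lambda>t. cmod (f t * g t))"
      using assms by (intro integrable_norm Lp_circ_2_mult_integrable)
    show "integrable circ (\<lambda>t. s * (cmod (f t))\<^sup>2 + (cmod (g t))\<^sup>2 / s)"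
      using assms by (simp add: Lp_circ_2_iff)
  qed (use am_gm in \<open>auto simp: norm_mult\<close>)
  also have "\<dots> = s * (\<integral>t. (cmod (f t))\<^sup>2 \<partial>circ) + (\<integral>t. (cmod (g t))\<^sup>2 \<partial>circ) / s"
    using assms by (simp add: Lp_circ_2_iff)
  finally show ?thesis .
qed

lemma norm_integral_mult_less:
  assumes "Lp_circ 2 g" "\<epsilon> > 0"
  obtains \<delta> where "\<delta> > 0"
    "\<And>f. Lp_circ 2 f \<Longrightarrow> (\<integral>t. (cmod (f t))\<^sup>2 \<partial>circ) < \<delta> \<Longrightarrow> cmod (\<integral>t. f t * g t \<partial>circ) < \<epsilon>"
proof -
  define N where "N = (\<integral>t. (cmod (g t))\<^sup>2 \<partial>circ)"
  \<comment> \<open>This weight makes the second term of the bound at most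
    \<open>\<epsilon> / 2\<close>; the summand 1 keeps it positive when \<open>g\<close> has norm
    0.\<close>
  define s where "s = 2 * (N + 1) / \<epsilon>"
  have "N \<ge> 0"
    by (simp add: N_def)
  then have "s > 0"
    using \<open>\<epsilon> > 0\<close> by (simp add: s_def)
  show ?thesis
  proof (rule that[of "\<epsilon> / (2 * s)"])
    show "\<epsilon> / (2 * s) > 0"
      using \<open>\<epsilon> > 0\<close> \<open>s > 0\<close> by simp
    fix f
    assume f: "Lp_circ 2 f" "(\<integral>t. (cmod (f t))\<^sup>2 \<partial>circ) < \<epsilon> / (2 * s)"
    have "s * (\<integral>t. (cmod (f t))\<^sup>2 \<partial>circ) < \<epsilon> / 2"
      using f(2) \<open>s > 0\<close> by (simp add: field_simps)
    moreover have "N / s \<le> \<epsilon> / 2"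
      using \<open>N \<ge> 0\<close> \<open>\<epsilon> > 0\<close> by (simp add: s_def field_simps)
    ultimately show "cmod (\<integral>t. f t * g t \<partial>circ) < \<epsilon>"
      using norm_integral_mult_le[OF f(1) assms(1) \<open>s > 0\<close>]
      unfolding N_def by linarith
  qed
qed

lemma integral_mult_tendsto_0:
  assumes "Lp_circ 2 g" "\<And>k. Lp_circ 2 (f k)"
    and "(\<lambda>k. \<integral>t. (cmod (f k t))\<^sup>2 \<partial>circ) \<longlonglongrightarrow> 0"
  shows "(\<lambda>k. \<integral>t. f k t * g t \<partial>circ) \<longlonglongrightarrow> 0"
proof (rule tendstoI)
  fix \<epsilon> :: real
  assume "\<epsilon> > 0"
  then obtain \<delta> where \<delta>: "\<delta> > 0"
    "\<And>f. Lp_circ 2 f \<Longrightarrow> (\<integral>t. (cmod (f t))\<^sup>2 \<partial>circ) < \<delta> \<Longrightarrow> cmod (\<integral>t. f t * g t \<partial>circ) < \<epsilon>"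
    using norm_integral_mult_less[OF assms(1)] by metis
  from order_tendstoD(2)[OF assms(3) \<delta>(1)]
  show "\<forall>\<^sub>F k in sequentially. dist (\<integral>t. f k t * g t \<partial>circ) 0 < \<epsilon>"
    by eventually_elim (simp add: \<delta>(2) assms(2))
qed

lemma fcoef_eq_0_iff:
  "fcoef f k = 0 \<longleftrightarrow> (\<integral>t. f t * exp (- \<i> * of_int k * of_real t) \<partial>circ) = 0"
  by (simp add: fcoef_def)

text \<open>A trigonometric polynomial close to \<open>h\<close> stays close when its negative frequencies are
  dropped, since these are orthogonal to \<open>h\<close> and to the remaining ones.\<close>

lemma Hp_2_annihilator:
  assumes h: "Hp_circ 2 h" and g: "Lp_circ 2 g"
    and ann: "\<And>k. k \<ge> 0 \<Longrightarrow> (\<integral>t. g t * exp (\<i> * of_int k * of_real t) \<partial>circ) = 0"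
  shows "(\<integral>t. g t * h t \<partial>circ) = 0"
proof (rule ccontr)
  assume "(\<integral>t. g t * h t \<partial>circ) \<noteq> 0"
  \<comment> \<open>The nonzero value itself serves as tolerance: a function of squared norm below
    \<open>\<delta>\<close> with the same integral against \<open>g\<close> as \<open>h\<close> is a
    contradiction.\<close>
  then obtain \<delta> where \<delta>: "\<delta> > 0" "\<And>f. Lp_circ 2 f \<Longrightarrow> (\<integral>t. (cmod (f t))\<^sup>2 \<partial>circ) < \<delta> \<Longrightarrow>
      cmod (\<integral>t. f t * g t \<partial>circ) < cmod (\<integral>t. g t * h t \<partial>circ)"
    using norm_integral_mult_less[OF g] by (metis zero_less_norm_iff)
  have h2: "Lp_circ 2 h"
    using h by (simp add: Hp_circ_def)
  obtain q where q: "trig_poly UNIV q" "(\<integral>t. (cmod (h t - q t))\<^sup>2 \<partial>circ) < \<delta>"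
    using Lp_2_trig_approx[OF h2] \<delta>(1) unfolding trig_approx_def by blast
  obtain q1 q2 where q12: "trig_poly {0..} q1" "trig_poly {..<0} q2" and q_eq: "q = (\<lambda>t. q1 t + q2 t)"
    using trig_poly_split[OF q(1)] by blast
  define u where "u = (\<lambda>t. h t - q1 t)"
  have u: "Lp_circ 2 u" and q2: "Lp_circ 2 q2"
    using h2 q12 by (auto simp: u_def intro: Lp_circ_2_diff trig_poly_Lp_2)
  \<comment> \<open>Neither \<open>h\<close> nor \<open>q1\<close> has negative frequencies.\<close>
  have perp: "(\<integral>t. u t * exp (- \<i> * of_int k * of_real t) \<partial>circ) = 0" if "k < 0" for k
  proof -
    have "(\<integral>t. exp (- \<i> * of_int k * of_real t) * q1 t \<partial>circ) = 0"
    proof (rule integral_trig_poly_eq_0[OF q12(1)])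
      fix l :: int
      assume "l \<in> {0..}"
      have "(\<lambda>t. exp (- \<i> * of_int k * complex_of_real t) * exp (\<i> * of_int l * of_real t)) =
          (\<lambda>t. exp (\<i> * of_int (l - k) * of_real t))"
        by (simp add: fun_eq_iff algebra_simps flip: exp_add)
      then show "(\<integral>t. exp (- \<i> * of_int k * of_real t) * exp (\<i> * of_int l * of_real t) \<partial>circ) = 0"
        using integral_exp_circ[of "l - k"] \<open>l \<in> {0..}\<close> that by (simp only:) auto
    qed (intro Lp_circ_infinity_imp_2 Lp_circ_infinity_exp)
    moreover have "(\<integral>t. h t * exp (- \<i> * of_int k * of_real t) \<partial>circ) = 0"
      using h that by (simp only: Hp_circ_def fcoef_eq_0_iff)
    moreover have "integrable circ (\<lambda>t. h t * exp (- \<i> * of_int k * of_real t))"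
      "integrable circ (\<lambda>t. exp (- \<i> * of_int k * of_real t) * q1 t)"
      by (intro Lp_circ_2_mult_integrable Lp_circ_infinity_imp_2[OF Lp_circ_infinity_exp(4)]
          h2 trig_poly_Lp_2[OF q12(1)])+
    moreover have "(\<lambda>t. u t * exp (- \<i> * of_int k * of_real t)) =
        (\<lambda>t. h t * exp (- \<i> * of_int k * of_real t) - exp (- \<i> * of_int k * of_real t) * q1 t)"
      by (simp add: u_def fun_eq_iff algebra_simps)
    ultimately show ?thesis
      by (simp only: Bochner_Integration.integral_diff diff_self)
  qed
  have int0: "(\<integral>t. cnj (u t) * q2 t \<partial>circ) = 0"
  proof (rule integral_trig_poly_eq_0[OF q12(2) Lp_circ_2_cnj[OF u]])
    fix k :: int
    assume "k \<in> {..<0}"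
    have "(\<lambda>t. cnj (u t) * exp (\<i> * of_int k * of_real t)) =
        (\<lambda>t. cnj (u t * exp (- \<i> * of_int k * of_real t)))"
      by (simp add: exp_cnj fun_eq_iff)
    then show "(\<integral>t. cnj (u t) * exp (\<i> * of_int k * of_real t) \<partial>circ) = 0"
      using perp \<open>k \<in> {..<0}\<close> by (simp only: Bochner_Integration.integral_cnj) simp
  qed
  have int: "integrable circ (\<lambda>t. cnj (u t) * q2 t)"
    by (intro Lp_circ_2_mult_integrable Lp_circ_2_cnj u q2)
  define r where "r = (\<lambda>t. Re (cnj (u t) * q2 t))"
  have r: "(\<integral>t. r t \<partial>circ) = 0" "integrable circ r"
    unfolding r_def
    using integral_Re[OF int] integrable_Re[OF int] int0 by (simp_all only: zero_complex.sel)
  \<comment> \<open>Since \<open>h - q = u - q2\<close>, this expands the square; the cross term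
    integrates to 0, so dropping \<open>q2\<close> does not increase the distance to
    \<open>h\<close>.\<close>
  have "(cmod (h t - q t))\<^sup>2 = (cmod (u t))\<^sup>2 + (cmod (q2 t))\<^sup>2 - 2 * r t" for t
    by (simp only: u_def q_eq r_def cmod_power2) (simp add: power2_eq_square algebra_simps)
  then have "(\<integral>t. (cmod (h t - q t))\<^sup>2 \<partial>circ) =
      (\<integral>t. (cmod (u t))\<^sup>2 \<partial>circ) + (\<integral>t. (cmod (q2 t))\<^sup>2 \<partial>circ)"
    using r u q2 by (simp add: Lp_circ_2_iff)
  moreover have "(\<integral>t. (cmod (q2 t))\<^sup>2 \<partial>circ) \<ge> 0"
    by simp
  ultimately have "(\<integral>t. (cmod (u t))\<^sup>2 \<partial>circ) < \<delta>"
    using q(2) by linarith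
  then have less: "cmod (\<integral>t. u t * g t \<partial>circ) < cmod (\<integral>t. g t * h t \<partial>circ)"
    by (intro \<delta>(2) u)
  \<comment> \<open>All frequencies of \<open>q1\<close> are among those that \<open>ann\<close>
    covers, so \<open>u\<close> and \<open>h\<close> have the same integral against
    \<open>g\<close>.\<close>
  have "(\<integral>t. g t * q1 t \<partial>circ) = 0"
    using q12(1) g by (rule integral_trig_poly_eq_0) (simp add: ann)
  moreover have "(\<lambda>t. u t * g t) = (\<lambda>t. g t * h t - g t * q1 t)"
    by (simp add: u_def fun_eq_iff algebra_simps)
  ultimately have "(\<integral>t. u t * g t \<partial>circ) = (\<integral>t. g t * h t \<partial>circ)"
    using Lp_circ_2_mult_integrable[OF g h2]
      Lp_circ_2_mult_integrable[OF g trig_poly_Lp_2[OF q12(1)]] by simp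
  with less show False
    by simp
qed

lemma fcoef_add_cmult:
  assumes "Lp_circ 2 f" "Lp_circ 2 g"
  shows "fcoef (\<lambda>t. f t + c * g t) k = fcoef f k + c * fcoef g k"
proof -
  have E: "Lp_circ 2 (\<lambda>t. exp (- \<i> * of_int k * of_real t))"
    by (intro Lp_circ_infinity_imp_2 Lp_circ_infinity_exp)
  have "(\<lambda>t. (f t + c * g t) * exp (- \<i> * of_int k * of_real t)) =
      (\<lambda>t. f t * exp (- \<i> * of_int k * of_real t) + c * (g t * exp (- \<i> * of_int k * of_real t)))"
    by (simp add: fun_eq_iff algebra_simps)
  then show ?thesis
    using Lp_circ_2_mult_integrable[OF assms(1) E] Lp_circ_2_mult_integrable[OF assms(2) E]
    unfolding fcoef_def by (simp add: distrib_left)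
qed

lemma fcoef_exp_mult:
  "fcoef (\<lambda>t. exp (\<i> * of_int l * of_real t) * f t) k = fcoef f (k - l)"
proof -
  have "exp (\<i> * of_int l * of_real t) * f t * exp (- \<i> * of_int k * of_real t) =
      f t * exp (- \<i> * of_int (k - l) * of_real t)" for t :: real
  proof -
    have "exp (- \<i> * of_int (k - l) * complex_of_real t) =
        exp (\<i> * of_int l * of_real t) * exp (- \<i> * of_int k * of_real t)"
      by (simp add: algebra_simps flip: exp_add)
    then show ?thesis
      by simp
  qed
  then show ?thesis
    by (simp only: fcoef_def)
qed

lemma fcoef_const: "fcoef (\<lambda>t. c) k = (if k = 0 then c else 0)"
  using integral_exp_circ[of "-k"] by (auto simp: fcoef_def)

lemma fcoef_0_eq: "fcoef f 0 = (\<integral>t. f t \<partial>circ) / (2 * pi)"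
  by (simp add: fcoef_def)

text \<open>Up to the factor 2 pi, the coefficient of the product at \<open>k < 0\<close> is the
  integral of \<open>h\<close> against \<open>exp (- \<i> * of_int k * of_real t) * g t\<close>.
  Pairing that factor with a frequency \<open>l \<ge> 0\<close> gives the coefficient of
  \<open>g\<close> at \<open>k - l < 0\<close>, so the factor annihilates H^2.\<close>

lemma Hp_circ_2_bounded_mult:
  assumes g: "Hp_circ \<infinity> g" and h: "Hp_circ 2 h"
  shows "Hp_circ 2 (\<lambda>t. g t * h t)"
  unfolding Hp_circ_def
proof (intro conjI allI impI)
  show "Lp_circ 2 (\<lambda>t. g t * h t)"
    using assms by (auto simp: Hp_circ_def intro: Lp_circ_2_bounded_mult)
  fix k :: int
  assume "k < 0"
  define g' where "g' = (\<lambda>t. exp (- \<i> * of_int k * of_real t) * g t)"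
  have "(\<integral>t. g' t * h t \<partial>circ) = 0"
  proof (rule Hp_2_annihilator[OF h])
    show "Lp_circ 2 g'"
      using g unfolding g'_def Hp_circ_def
      by (intro Lp_circ_infinity_imp_2 Lp_circ_infinity_mult Lp_circ_infinity_exp) auto
    fix l :: int
    assume "l \<ge> 0"
    then have "fcoef g (k - l) = 0"
      using g \<open>k < 0\<close> by (simp add: Hp_circ_def)
    moreover have "g' t * exp (\<i> * of_int l * of_real t) =
        g t * exp (- \<i> * of_int (k - l) * of_real t)" for t
    proof -
      have "exp (- \<i> * of_int (k - l) * complex_of_real t) =
          exp (\<i> * of_int l * of_real t) * exp (- \<i> * of_int k * of_real t)"
        by (simp add: algebra_simps flip: exp_add)
      then show ?thesis
        by (simp add: g'_def)
    qed
    ultimately show "(\<integral>t. g' t * exp (\<i> * of_int l * of_real t) \<partial>circ) = 0"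
      by (simp only: fcoef_eq_0_iff)
  qed
  moreover have "(\<lambda>t. g' t * h t) = (\<lambda>t. g t * h t * exp (- \<i> * of_int k * of_real t))"
    by (simp add: g'_def fun_eq_iff)
  ultimately show "fcoef (\<lambda>t. g t * h t) k = 0"
    by (simp only: fcoef_eq_0_iff)
qed

subsection \<open>Vector-valued functions and the model space\<close>

lemma Hp_circ_imp_Lp: "Hp_circ p f \<Longrightarrow> Lp_circ p f"
  by (simp add: Hp_circ_def)

lemma Hp_circ_infinity_imp_2: "Hp_circ \<infinity> f \<Longrightarrow> Hp_circ 2 f"
  by (auto simp: Hp_circ_def intro: Lp_circ_infinity_imp_2)

lemma Lp_circ_add_cmult:
  assumes "p = 2 \<or> p = \<infinity>" "Lp_circ p f" "Lp_circ p g"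
  shows "Lp_circ p (\<lambda>t. f t + c * g t)"
  using assms by (auto intro: Lp_circ_2_add Lp_circ_2_cmult
      intro!: Lp_circ_infinity_add Lp_circ_infinity_mult[OF Lp_circ_infinity_const])

lemma Hp_circ_add_cmult:
  assumes "p = 2 \<or> p = \<infinity>" "Hp_circ p f" "Hp_circ p g"
  shows "Hp_circ p (\<lambda>t. f t + c * g t)"
proof -
  have "Lp_circ 2 f" "Lp_circ 2 g"
    using assms Lp_circ_infinity_imp_2 by (auto simp: Hp_circ_def)
  then show ?thesis
    using assms Lp_circ_add_cmult[of p f g c] by (simp add: Hp_circ_def fcoef_add_cmult)
qed

lemma Hp_circ_const: "p = 2 \<or> p = \<infinity> \<Longrightarrow> Hp_circ p (\<lambda>t. c)"
  using Lp_circ_infinity_const[of c] Lp_circ_2_const[of c] by (auto simp: Hp_circ_def fcoef_const)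

text \<open>Complex subspaces as predicates, a form shared by \<open>vLp\<close>,
  \<open>vHp\<close>, the model space, the domain and later \<open>null_lim\<close>, so that closure
  under finite linear combinations is proved once.\<close>

definition lin_closed :: "((real \<Rightarrow> 'n \<Rightarrow> complex) \<Rightarrow> bool) \<Rightarrow> bool" where
  "lin_closed P \<longleftrightarrow> P (\<lambda>t i. 0) \<and> (\<forall>f g c. P f \<longrightarrow> P g \<longrightarrow> P (\<lambda>t i. f t i + c * g t i))"

lemma lin_closed_0: "lin_closed P \<Longrightarrow> P (\<lambda>t i. 0)"
  by (simp add: lin_closed_def)

lemma lin_closed_add_cmult: "lin_closed P \<Longrightarrow> P f \<Longrightarrow> P g \<Longrightarrow> P (\<lambda>t i. f t i + c * g t i)"
  by (simp add: lin_closed_def)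

lemma lin_closed_diff: "lin_closed P \<Longrightarrow> P f \<Longrightarrow> P g \<Longrightarrow> P (\<lambda>t i. f t i - g t i)"
  using lin_closed_add_cmult[of P f g "-1"] by simp

lemma lin_closed_sum:
  assumes "lin_closed P" "\<And>j. j \<in> A \<Longrightarrow> P (x j)"
  shows "P (\<lambda>t i. \<Sum>j\<in>A. c j * x j t i)"
  using assms(2)
proof (induction A rule: infinite_finite_induct)
  case (insert a A)
  then show ?case
    using lin_closed_add_cmult[OF assms(1), of "\<lambda>t i. \<Sum>j\<in>A. c j * x j t i" "x a" "c a"]
    by (simp add: add.commute)
qed (use lin_closed_0[OF assms(1)] in auto)

lemma lin_closed_vLp: "p = 2 \<or> p = \<infinity> \<Longrightarrow> lin_closed (vLp p)"
  using Lp_circ_infinity_const[of 0] Lp_circ_2_const[of 0]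
  by (auto simp: lin_closed_def vLp_def intro: Lp_circ_add_cmult)

lemma lin_closed_vHp: "p = 2 \<or> p = \<infinity> \<Longrightarrow> lin_closed (vHp p)"
  by (auto simp: lin_closed_def vHp_def intro: Hp_circ_add_cmult Hp_circ_const)

lemma vHp_imp_vLp: "vHp p f \<Longrightarrow> vLp p f"
  by (simp add: vHp_def vLp_def Hp_circ_imp_Lp)

lemma vHp_infinity_imp_2: "vHp \<infinity> f \<Longrightarrow> vHp 2 f"
  by (simp add: vHp_def Hp_circ_infinity_imp_2)

lemma vHp_const: "p = 2 \<or> p = \<infinity> \<Longrightarrow> vHp p (\<lambda>t. c)"
  by (simp add: vHp_def Hp_circ_const)

lemma vLp_const: "vLp 2 (\<lambda>t. c)"
  by (simp add: vLp_def Lp_circ_2_const)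

lemma vinner_integrable:
  assumes "vLp 2 F" "vLp 2 H"
  shows "integrable circ (\<lambda>t. F t i * cnj (H t i))"
  using assms by (intro Lp_circ_2_mult_integrable Lp_circ_2_cnj) (auto simp: vLp_def)

lemma vinner_eq_sum:
  assumes "vLp 2 F" "vLp 2 H"
  shows "vinner F H = (\<Sum>i\<in>UNIV. \<integral>t. F t i * cnj (H t i) \<partial>circ)"
  unfolding vinner_def using vinner_integrable[OF assms] by (intro Bochner_Integration.integral_sum)

lemma vinner_commute: "vinner F H = cnj (vinner H F)"
  unfolding vinner_def Bochner_Integration.integral_cnj[symmetric] by (simp add: mult.commute)

lemma vinner_add_cmult_left:
  assumes "vLp 2 F" "vLp 2 F'" "vLp 2 H"
  shows "vinner (\<lambda>t i. F t i + c * F' t i) H = vinner F H + c * vinner F' H"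
proof -
  have "(\<Sum>i\<in>UNIV. (F t i + c * F' t i) * cnj (H t i)) =
      (\<Sum>i\<in>UNIV. F t i * cnj (H t i)) + c * (\<Sum>i\<in>UNIV. F' t i * cnj (H t i))" for t
    by (simp add: algebra_simps sum.distrib sum_distrib_left)
  then show ?thesis
    unfolding vinner_def using vinner_integrable[of F H] vinner_integrable[of F' H] assms by simp
qed

lemma vinner_add_cmult_right:
  assumes "vLp 2 F" "vLp 2 H" "vLp 2 H'"
  shows "vinner F (\<lambda>t i. H t i + c * H' t i) = vinner F H + cnj c * vinner F H'"
  using assms vinner_add_cmult_left[of H H' F c] by (simp add: vinner_commute[of F])

lemma vinner_diff_left:
  assumes "vLp 2 F" "vLp 2 F'" "vLp 2 H"
  shows "vinner (\<lambda>t i. F t i - F' t i) H = vinner F H - vinner F' H"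
  using vinner_add_cmult_left[OF assms, of "-1"] by simp

lemma vinner_0_left [simp]: "vinner (\<lambda>t i. 0) H = 0"
  by (simp add: vinner_def)

lemma vinner_sum_left:
  assumes "vLp 2 H" "\<And>j. j \<in> A \<Longrightarrow> vLp 2 (x j)"
  shows "vinner (\<lambda>t i. \<Sum>j\<in>A. c j * x j t i) H = (\<Sum>j\<in>A. c j * vinner (x j) H)"
  using assms(2)
proof (induction A rule: infinite_finite_induct)
  case (insert a A)
  have "vLp 2 (\<lambda>t i. \<Sum>j\<in>A. c j * x j t i)"
    using insert by (intro lin_closed_sum[OF lin_closed_vLp]) auto
  then show ?case
    using insert vinner_add_cmult_left[of "\<lambda>t i. \<Sum>j\<in>A. c j * x j t i" "x a" H "c a"] assms(1)
    by (simp add: add.commute)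
qed auto

lemma vinner_sum_right:
  assumes "vLp 2 F" "\<And>j. j \<in> A \<Longrightarrow> vLp 2 (x j)"
  shows "vinner F (\<lambda>t i. \<Sum>j\<in>A. c j * x j t i) = (\<Sum>j\<in>A. cnj (c j) * vinner F (x j))"
  using vinner_sum_left[of F A x c] assms by (simp add: vinner_commute[of F])

lemma vLp_mvmult_bounded:
  assumes "mLp \<infinity> \<Theta>" "vLp 2 h"
  shows "vLp 2 (mvmult \<Theta> h)"
  using assms unfolding vLp_def mLp_def mvmult_def
  by (auto intro!: Lp_circ_2_sum Lp_circ_2_bounded_mult)

lemma vLp_mvmult_bounded_right:
  assumes "mLp 2 G" "vLp \<infinity> f"
  shows "vLp 2 (mvmult G f)"
proof -
  have "Lp_circ 2 (\<lambda>t. G t i j * f t j)" for i j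
    using Lp_circ_2_bounded_mult[of "\<lambda>t. f t j" "\<lambda>t. G t i j"] assms
    by (simp add: vLp_def mLp_def mult.commute)
  then show ?thesis
    unfolding vLp_def mvmult_def by (auto intro!: Lp_circ_2_sum)
qed

lemma mvmult_add_cmult:
  "mvmult G (\<lambda>t i. f t i + c * g t i) = (\<lambda>t i. mvmult G f t i + c * mvmult G g t i)"
  by (simp add: mvmult_def fun_eq_iff algebra_simps sum.distrib sum_distrib_left)

definition unit_vec :: "'n \<Rightarrow> 'n \<Rightarrow> complex" where
  "unit_vec j = (\<lambda>i. if i = j then 1 else 0)"

lemma mvmult_const:
  "mvmult \<Theta> (\<lambda>t. c) = (\<lambda>t i. \<Sum>j\<in>UNIV. c j * mvmult \<Theta> (\<lambda>t. unit_vec j) t i)"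
  by (simp add: mvmult_def fun_eq_iff unit_vec_def if_distrib mult.commute cong: if_cong)

section \<open>Shift and backward shift of vector functions\<close>

definition zmult :: "(real \<Rightarrow> 'n \<Rightarrow> complex) \<Rightarrow> real \<Rightarrow> 'n \<Rightarrow> complex" where
  "zmult f = (\<lambda>t i. exp (\<i> * of_real t) * f t i)"

lemma exp_circ_inverse:
  "exp (\<i> * of_real t) * exp (- \<i> * of_real t) = (1::complex)"
  by (simp flip: exp_add)

lemma cnj_exp_circ: "cnj (exp (\<i> * of_real t)) = exp (- \<i> * of_real t)"
  by (simp add: exp_cnj)

lemma vLp_zmult: "vLp 2 f \<Longrightarrow> vLp 2 (zmult f)"
  by (simp add: vLp_def zmult_def Lp_circ_2_bounded_mult Lp_circ_infinity_exp)

lemma fcoef_zmult: "fcoef (\<lambda>t. zmult f t i) k = fcoef (\<lambda>t. f t i) (k - 1)"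
  using fcoef_exp_mult[of 1 "\<lambda>t. f t i" k] by (simp add: zmult_def)

lemma vHp_zmult: "vHp 2 f \<Longrightarrow> vHp 2 (zmult f)"
  using vLp_zmult[of f] by (simp add: vHp_def vLp_def Hp_circ_def fcoef_zmult)

lemma mvmult_zmult: "mvmult \<Theta> (zmult h) = zmult (mvmult \<Theta> h)"
  by (simp add: mvmult_def zmult_def fun_eq_iff sum_distrib_left mult.left_commute)

lemma vinner_zmult_zmult: "vinner (zmult F) (zmult H) = vinner F H"
proof -
  have "zmult F t i * cnj (zmult H t i) = F t i * cnj (H t i)" for t i
  proof -
    have "zmult F t i * cnj (zmult H t i) =
        (exp (\<i> * of_real t) * exp (- \<i> * of_real t)) * (F t i * cnj (H t i))"
      by (simp only: zmult_def complex_cnj_mult cnj_exp_circ mult_ac)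
    then show ?thesis
      by (simp only: exp_circ_inverse mult_1)
  qed
  then show ?thesis
    by (simp only: vinner_def)
qed

lemma bshift_eq_if_val0_eq_0:
  "val0 f = (\<lambda>i. 0) \<Longrightarrow> bshift f = (\<lambda>t i. exp (- \<i> * of_real t) * f t i)"
  by (simp add: bshift_def mult.commute)

text \<open>Reduces inner products and norms involving the backward shift to the isometry
  \<open>zmult\<close>.\<close>

lemma zmult_bshift: "zmult (bshift f) = (\<lambda>t i. f t i - val0 f i)"
proof -
  have "zmult (bshift f) t i = (f t i - val0 f i) * (exp (\<i> * of_real t) * exp (- \<i> * of_real t))" for t i
    by (simp only: zmult_def bshift_def mult_ac)
  then show ?thesis
    by (simp only: fun_eq_iff exp_circ_inverse mult_1_right simp_thms)
qed

lemma vHp_bshift: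
  assumes "p = 2 \<or> p = \<infinity>" "vHp p f"
  shows "vHp p (bshift f)"
proof -
  have f2: "vLp 2 f"
    using assms vHp_imp_vLp vHp_infinity_imp_2 by blast
  have "Hp_circ p (\<lambda>t. bshift f t i)" for i
  proof -
    have Lp: "Lp_circ p (\<lambda>t. f t i + (-1) * val0 f i)"
      using assms by (intro Lp_circ_add_cmult Hp_circ_imp_Lp[OF Hp_circ_const])
        (auto simp: vHp_def Hp_circ_def)
    have eq: "(\<lambda>t. bshift f t i) = (\<lambda>t. exp (- \<i> * of_real t) * (f t i + (-1) * val0 f i))"
      by (simp add: bshift_def fun_eq_iff)
    have "Lp_circ p (\<lambda>t. bshift f t i)"
      unfolding eq using assms(1) Lp
        Lp_circ_2_bounded_mult[OF Lp_circ_infinity_exp(2)] Lp_circ_infinity_mult[OF Lp_circ_infinity_exp(2)]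
      by blast
    moreover have "fcoef (\<lambda>t. bshift f t i) k = 0" if "k < 0" for k
    proof -
      have "fcoef (\<lambda>t. bshift f t i) k = fcoef (\<lambda>t. f t i + (-1) * val0 f i) (k + 1)"
        using fcoef_exp_mult[of "-1" "\<lambda>t. f t i + (-1) * val0 f i" k] by (simp add: eq)
      also have "\<dots> = fcoef (\<lambda>t. f t i) (k + 1) + (-1) * fcoef (\<lambda>t. val0 f i) (k + 1)"
        using f2 by (intro fcoef_add_cmult Lp_circ_2_const) (simp add: vLp_def)
      \<comment> \<open>The index \<open>k + 1\<close> is still negative except for
        \<open>k = -1\<close>; there the subtracted constant cancels the coefficient of index
        0.\<close>
      also have "\<dots> = 0"
        using assms(2) that by (cases "k = -1") (auto simp: fcoef_const val0_def vHp_def Hp_circ_def)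
      finally show ?thesis .
    qed
    ultimately show ?thesis
      by (simp add: Hp_circ_def)
  qed
  then show ?thesis
    by (simp add: vHp_def)
qed

text \<open>A constant meets only the Fourier coefficients of index 0, and \<open>2 * pi\<close> is
  the total mass of the circle.\<close>

lemma vinner_const_left:
  assumes "vLp 2 h"
  shows "vinner (\<lambda>t. c) h = 2 * pi * (\<Sum>j\<in>UNIV. c j * cnj (val0 h j))"
proof -
  have "vinner (\<lambda>t. c) h = (\<Sum>j\<in>UNIV. \<integral>t. c j * cnj (h t j) \<partial>circ)"
    using assms by (intro vinner_eq_sum vLp_const)
  also have "\<dots> = (\<Sum>j\<in>UNIV. c j * (2 * pi * cnj (val0 h j)))"
    by (simp add: val0_def fcoef_0_eq)
  finally show ?thesis
    by (simp add: sum_distrib_left mult_ac)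
qed

text \<open>Applying \<open>zmult\<close> to both arguments turns the first into \<open>v\<close>
  minus a constant, and constants are orthogonal to \<open>zmult w\<close>, whose value at 0 is 0.
  This is the adjointness of the two shifts on H^2.\<close>

lemma vinner_bshift:
  assumes "vHp 2 v" "vHp 2 w"
  shows "vinner (bshift v) w = vinner v (zmult w)"
proof -
  have L: "vLp 2 v" "vLp 2 (zmult w)"
    using assms by (simp_all add: vLp_zmult vHp_imp_vLp)
  have "vinner (bshift v) w = vinner (\<lambda>t i. v t i - val0 v i) (zmult w)"
    unfolding zmult_bshift[symmetric] vinner_zmult_zmult ..
  also have "\<dots> = vinner v (zmult w) - vinner (\<lambda>t. val0 v) (zmult w)"
    using L vLp_const by (intro vinner_diff_left)
  also have "vinner (\<lambda>t. val0 v) (zmult w) = 0"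
    using L assms(2) by (simp add: vinner_const_left val0_def fcoef_zmult) (simp add: vHp_def Hp_circ_def)
  finally show ?thesis
    by simp
qed

section \<open>Inner matrices and the model space\<close>

lemma matrix_inner_mLp: "matrix_inner \<Theta> \<Longrightarrow> mLp \<infinity> \<Theta>"
  by (simp add: matrix_inner_def mLp_def Hp_circ_def)

lemma vHp_mvmult_inner:
  assumes "matrix_inner \<Theta>" "vHp 2 h"
  shows "vHp 2 (mvmult \<Theta> h)"
proof -
  have "Hp_circ 2 (\<lambda>t. \<Theta> t i j * h t j)" for i j
    using assms by (intro Hp_circ_2_bounded_mult) (auto simp: matrix_inner_def vHp_def)
  then have "vHp 2 (\<lambda>t i. \<Theta> t i j * h t j)" for j
    by (simp add: vHp_def)
  then show ?thesis
    using lin_closed_sum[OF lin_closed_vHp, of 2 UNIV "\<lambda>j t i. \<Theta> t i j * h t j" "\<lambda>j. 1"]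
    by (simp add: mvmult_def)
qed

text \<open>The columns of \<open>\<Theta> t\<close> are orthonormal for almost every
  \<open>t\<close>, so the integrands agree almost everywhere.\<close>

lemma vinner_mvmult_inner:
  assumes "matrix_inner \<Theta>" "vLp 2 a" "vLp 2 b"
  shows "vinner (mvmult \<Theta> a) (mvmult \<Theta> b) = vinner a b"
  unfolding vinner_def
proof (rule integral_cong_AE)
  have L: "vLp 2 (mvmult \<Theta> a)" "vLp 2 (mvmult \<Theta> b)"
    using assms by (simp_all add: matrix_inner_mLp vLp_mvmult_bounded)
  show "(\<lambda>t. \<Sum>i\<in>UNIV. mvmult \<Theta> a t i * cnj (mvmult \<Theta> b t i)) \<in> borel_measurable circ"
    "(\<lambda>t. \<Sum>i\<in>UNIV. a t i * cnj (b t i)) \<in> borel_measurable circ"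
    using vinner_integrable[OF L] vinner_integrable[OF assms(2,3)] by auto
  have "AE t in circ. \<forall>i j. (\<Sum>k\<in>UNIV. cnj (\<Theta> t k i) * \<Theta> t k j) = (if i = j then 1 else 0)"
    using assms(1) by (auto simp: matrix_inner_def)
  then show "AE t in circ. (\<Sum>i\<in>UNIV. mvmult \<Theta> a t i * cnj (mvmult \<Theta> b t i)) =
      (\<Sum>i\<in>UNIV. a t i * cnj (b t i))"
  proof eventually_elim
    case (elim t)
    have "(\<Sum>i\<in>UNIV. mvmult \<Theta> a t i * cnj (mvmult \<Theta> b t i)) =
        (\<Sum>i\<in>UNIV. \<Sum>j\<in>UNIV. \<Sum>l\<in>UNIV. (\<Theta> t i j * a t j) * (cnj (\<Theta> t i l) * cnj (b t l)))"
      by (simp add: mvmult_def sum_product)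
    also have "\<dots> = (\<Sum>j\<in>UNIV. \<Sum>l\<in>UNIV. \<Sum>i\<in>UNIV. (\<Theta> t i j * a t j) * (cnj (\<Theta> t i l) * cnj (b t l)))"
      by (subst sum.swap, rule sum.cong[OF refl], rule sum.swap)
    also have "\<dots> = (\<Sum>j\<in>UNIV. \<Sum>l\<in>UNIV. a t j * cnj (b t l) * (\<Sum>i\<in>UNIV. cnj (\<Theta> t i l) * \<Theta> t i j))"
      by (simp add: sum_distrib_left mult_ac)
    also have "\<dots> = (\<Sum>j\<in>UNIV. a t j * cnj (b t j))"
      by (simp add: elim if_distrib cong: if_cong)
    finally show ?case .
  qed
qed

definition mvadj :: "(real \<Rightarrow> 'n::finite \<Rightarrow> 'n \<Rightarrow> complex) \<Rightarrow> (real \<Rightarrow> 'n \<Rightarrow> complex)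
    \<Rightarrow> real \<Rightarrow> 'n \<Rightarrow> complex" where
  "mvadj G H = (\<lambda>t j. \<Sum>i\<in>UNIV. cnj (G t i j) * H t i)"

lemma vinner_mvmult_left: "vinner (mvmult G f) H = vinner f (mvadj G H)"
proof -
  have "(\<Sum>i\<in>UNIV. mvmult G f t i * cnj (H t i)) = (\<Sum>j\<in>UNIV. f t j * cnj (mvadj G H t j))" for t
    unfolding mvmult_def mvadj_def sum_distrib_right
    by (subst sum.swap) (simp add: sum_distrib_left mult_ac)
  then show ?thesis
    by (simp only: vinner_def)
qed

lemma vLp_mvadj:
  assumes "mLp 2 G" "vLp \<infinity> H"
  shows "vLp 2 (mvadj G H)"
proof -
  have "mvadj G H = mvmult (\<lambda>t j i. cnj (G t i j)) H"
    by (simp add: mvadj_def mvmult_def)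
  moreover have "mLp 2 (\<lambda>t j i. cnj (G t i j))"
    using assms(1) by (simp add: mLp_def Lp_circ_2_cnj)
  ultimately show ?thesis
    using assms(2) vLp_mvmult_bounded_right by metis
qed

lemma lin_closed_model_space:
  assumes "matrix_inner \<Theta>"
  shows "lin_closed (\<lambda>f. f \<in> model_space \<Theta>)"
proof -
  have "vinner (\<lambda>t i. f t i + c * g t i) (mvmult \<Theta> h) =
      vinner f (mvmult \<Theta> h) + c * vinner g (mvmult \<Theta> h)"
    if "vHp 2 f" "vHp 2 g" "vHp 2 h" for f g h c
    using that assms
    by (intro vinner_add_cmult_left vLp_mvmult_bounded matrix_inner_mLp vHp_imp_vLp)
  then show ?thesis
    using lin_closed_vHp[of 2] by (auto simp: lin_closed_def model_space_def)
qed

lemma model_space_vHp: "f \<in> model_space \<Theta> \<Longrightarrow> vHp 2 f"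
  by (simp add: model_space_def)

lemma model_space_vLp: "f \<in> model_space \<Theta> \<Longrightarrow> vLp 2 f"
  by (simp add: model_space_def vHp_imp_vLp)

lemma lin_closed_mtto_dom:
  assumes "matrix_inner \<Theta>"
  shows "lin_closed (\<lambda>f. f \<in> mtto_dom \<Theta>)"
  using lin_closed_model_space[OF assms] lin_closed_vHp[of \<infinity>]
  by (auto simp: lin_closed_def mtto_dom_def)

lemma is_PK_add_cmult:
  assumes "matrix_inner \<Theta>" "vLp 2 u" "vLp 2 u'" "is_PK \<Theta> u v" "is_PK \<Theta> u' v'"
  shows "is_PK \<Theta> (\<lambda>t i. u t i + c * u' t i) (\<lambda>t i. v t i + c * v' t i)"
  unfolding is_PK_def
proof (intro conjI ballI)
  have v: "v \<in> model_space \<Theta>" "v' \<in> model_space \<Theta>"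
    using assms by (auto simp: is_PK_def)
  then show "(\<lambda>t i. v t i + c * v' t i) \<in> model_space \<Theta>"
    by (intro lin_closed_add_cmult[OF lin_closed_model_space[OF assms(1)]])
  fix w
  assume w: "w \<in> model_space \<Theta>"
  have eq: "(\<lambda>t i. u t i + c * u' t i - (v t i + c * v' t i)) =
      (\<lambda>t i. (u t i - v t i) + c * (u' t i - v' t i))"
    by (simp add: fun_eq_iff algebra_simps)
  have "vinner (\<lambda>t i. u t i + c * u' t i - (v t i + c * v' t i)) w = vinner (\<lambda>t i. u t i - v t i) w + c * vinner (\<lambda>t i. u' t i - v' t i) w"
    unfolding eq using assms(2,3) v w lin_closed_diff[OF lin_closed_vLp[of 2]]
    by (intro vinner_add_cmult_left) (blast intro: model_space_vLp)+
  also have "\<dots> = 0"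
    using assms w by (simp add: is_PK_def)
  finally show "vinner (\<lambda>t i. u t i + c * u' t i - (v t i + c * v' t i)) w = 0" .
qed

text \<open>Dual to the invariance of Theta H^2 under multiplication by z, which commutes with
  \<open>\<Theta>\<close>.\<close>

lemma bshift_model_space:
  assumes "matrix_inner \<Theta>" "v \<in> model_space \<Theta>"
  shows "bshift v \<in> model_space \<Theta>"
  unfolding model_space_def
proof (intro CollectI conjI allI impI)
  show "vHp 2 (bshift v)"
    using assms(2) by (intro vHp_bshift) (auto simp: model_space_def)
  fix h :: "real \<Rightarrow> 'a \<Rightarrow> complex"
  assume h: "vHp 2 h"
  have "vinner (bshift v) (mvmult \<Theta> h) = vinner v (mvmult \<Theta> (zmult h))"
    unfolding mvmult_zmult
    by (intro vinner_bshift vHp_mvmult_inner assms h model_space_vHp[OF assms(2)])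
  then show "vinner (bshift v) (mvmult \<Theta> h) = 0"
    using assms(2) vHp_zmult[OF h] by (simp add: model_space_def)
qed

text \<open>As \<open>\<Theta>\<close> is isometric, the pairing reduces to that of the constant
  \<open>c\<close> with \<open>zmult h\<close>, a function whose value at 0 is 0. These functions
  carry the correction terms of the projection.\<close>

lemma bshift_inner_model_space:
  assumes "matrix_inner \<Theta>"
  shows "bshift (mvmult \<Theta> (\<lambda>t. c)) \<in> model_space \<Theta>"
  unfolding model_space_def
proof (intro CollectI conjI allI impI)
  have c: "vHp 2 (mvmult \<Theta> (\<lambda>t. c))"
    by (intro vHp_mvmult_inner assms vHp_const) auto
  then show "vHp 2 (bshift (mvmult \<Theta> (\<lambda>t. c)))"
    by (intro vHp_bshift) auto
  fix h :: "real \<Rightarrow> 'a \<Rightarrow> complex"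
  assume h: "vHp 2 h"
  have "vinner (bshift (mvmult \<Theta> (\<lambda>t. c))) (mvmult \<Theta> h) =
      vinner (mvmult \<Theta> (\<lambda>t. c)) (mvmult \<Theta> (zmult h))"
    unfolding mvmult_zmult by (intro vinner_bshift vHp_mvmult_inner assms h c)
  also have "\<dots> = vinner (\<lambda>t. c) (zmult h)"
    by (intro vinner_mvmult_inner assms vLp_const vLp_zmult vHp_imp_vLp h)
  also have "\<dots> = 0"
    using h vLp_zmult[OF vHp_imp_vLp[OF h]]
    by (simp add: vinner_const_left val0_def fcoef_zmult) (simp add: vHp_def Hp_circ_def)
  finally show "vinner (bshift (mvmult \<Theta> (\<lambda>t. c))) (mvmult \<Theta> h) = 0" .
qed

subsection \<open>Projections of backward shifts\<close>

text \<open>Gaussian elimination in a form suited to limits: the spanning vectors stay inside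
  \<open>S\<close> and are indexed by \<open>'n\<close>, and the matrix \<open>m\<close> makes the
  coordinates linear in \<open>v\<close>, so that they tend to 0 along with \<open>v\<close>. The
  induction is over the set \<open>I\<close> of positions where members of \<open>S\<close> may be
  nonzero.\<close>

lemma subspace_linear_coordinates:
  fixes S :: "('n::finite \<Rightarrow> complex) set"
  assumes "(\<lambda>i. 0) \<in> S" "\<And>v w c. v \<in> S \<Longrightarrow> w \<in> S \<Longrightarrow> (\<lambda>i. v i + c * w i) \<in> S"
  obtains \<phi> m where "\<And>j. \<phi> j \<in> S"
    "\<And>v i. v \<in> S \<Longrightarrow> v i = (\<Sum>j\<in>UNIV. (\<Sum>l\<in>UNIV. m j l * v l) * \<phi> (j::'n) i)"
proof -
  have "\<exists>\<phi> m. (\<forall>j. \<phi> j \<in> S) \<and>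
      (\<forall>v\<in>S. \<forall>i. v i = (\<Sum>j\<in>I. (\<Sum>l\<in>UNIV. m j l * v l) * \<phi> (j::'n) i))"
    if "finite I" "\<And>v i. v \<in> S \<Longrightarrow> i \<notin> I \<Longrightarrow> v i = 0" for I :: "'n set"
    using that assms
  proof (induction I arbitrary: S rule: finite_induct)
    case empty
    then show ?case
      by (intro exI[of _ "\<lambda>j i. 0"]) auto
  next
    case (insert a I)
    \<comment> \<open>Requiring the entry at \<open>a\<close> to vanish leaves a subspace supported
      on \<open>I\<close>.\<close>
    define S' where "S' = {v \<in> S. v a = 0}"
    have "\<exists>\<phi> m. (\<forall>j. \<phi> j \<in> S') \<and>
        (\<forall>v\<in>S'. \<forall>i. v i = (\<Sum>j\<in>I. (\<Sum>l\<in>UNIV. m j l * v l) * \<phi> (j::'n) i))"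
    proof (rule insert.IH)
      fix v i
      assume "v \<in> S'" "i \<notin> I"
      then show "v i = 0"
        using insert.prems(1)[of v i] by (cases "i = a") (auto simp: S'_def)
    qed (use insert.prems(2,3) in \<open>auto simp: S'_def\<close>)
    then obtain \<phi> m where \<phi>: "\<And>j. \<phi> j \<in> S'"
      and m: "\<And>v i. v \<in> S' \<Longrightarrow> v i = (\<Sum>j\<in>I. (\<Sum>l\<in>UNIV. m j l * v l) * \<phi> j i)"
      by blast
    show ?case
    proof (cases "\<forall>v\<in>S. v a = 0")
      case True
      then have "S' = S"
        by (auto simp: S'_def)
      then show ?thesis
        using \<phi>
      proof (intro exI conjI allI ballI)
        fix v i
        assume "v \<in> S"
        \<comment> \<open>No member of \<open>S\<close> has an entry at \<open>a\<close>, so the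
          index \<open>a\<close> receives a zero row.\<close>
        have "(\<Sum>j\<in>insert a I. (\<Sum>l\<in>UNIV. (if j = a then 0 else m j l) * v l) * \<phi> j i) =
            (\<Sum>j\<in>I. (\<Sum>l\<in>UNIV. (if j = a then 0 else m j l) * v l) * \<phi> j i)"
          using insert.hyps by simp
        also have "\<dots> = (\<Sum>j\<in>I. (\<Sum>l\<in>UNIV. m j l * v l) * \<phi> j i)"
          using insert.hyps by (intro sum.cong[OF refl] arg_cong2[of _ _ _ _ "(*)"]) auto
        also have "\<dots> = v i"
          using m[of v i, symmetric] \<open>v \<in> S\<close> \<open>S' = S\<close> by (simp only:)
        finally show "v i = (\<Sum>j\<in>insert a I. (\<Sum>l\<in>UNIV. (if j = a then 0 else m j l) * v l) * \<phi> j i)" ..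
      qed simp
    next
      case False
      then obtain u0 where u0: "u0 \<in> S" "u0 a \<noteq> 0"
        by blast
      define u where "u = (\<lambda>i. u0 i / u0 a)"
      have "(\<lambda>i. 0 + (1 / u0 a) * u0 i) \<in> S"
        using insert.prems u0 by blast
      then have u: "u \<in> S" "u a = 1"
        using u0 by (simp_all add: u_def)
      define \<phi>' where "\<phi>' j = (if j = a then u else \<phi> j)" for j
      \<comment> \<open>Row \<open>a\<close> reads off \<open>v a\<close>. Every other row applies
        the old one to \<open>v\<close> minus \<open>v a\<close> times \<open>u\<close>, a member of
        \<open>S'\<close>; the change in column \<open>a\<close> has this effect.\<close>
      define m' where "m' j l = (if j = a then (if l = a then 1 else 0)
          else m j l - (if l = a then \<Sum>k\<in>UNIV. m j k * u k else 0))" for j l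
      have "v i = (\<Sum>j\<in>insert a I. (\<Sum>l\<in>UNIV. m' j l * v l) * \<phi>' j i)" if "v \<in> S" for v i
      proof -
        define w where "w = (\<lambda>i. v i + (- v a) * u i)"
        have "w \<in> S'"
          using insert.prems(3)[OF that u(1), of "- v a"] u by (simp add: w_def S'_def)
        have coef: "(\<Sum>l\<in>UNIV. m j l * w l) = (\<Sum>l\<in>UNIV. m' j l * v l)" if "j \<noteq> a" for j
        proof -
          have "(\<Sum>l\<in>UNIV. m' j l * v l) =
              (\<Sum>l\<in>UNIV. m j l * v l) - (\<Sum>l\<in>UNIV. if l = a then (\<Sum>k\<in>UNIV. m j k * u k) * v a else 0)"
            unfolding sum_subtractf[symmetric] using that
            by (intro sum.cong) (auto simp: m'_def algebra_simps)
          also have "\<dots> = (\<Sum>l\<in>UNIV. m j l * w l)"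
            by (simp add: w_def algebra_simps sum.distrib sum_subtractf sum_distrib_left sum_distrib_right)
          finally show ?thesis ..
        qed
        have "(\<Sum>l\<in>UNIV. m' a l * v l) = v a"
          by (simp add: m'_def if_distrib[of "\<lambda>x. x * _"] cong: if_cong)
        then have "(\<Sum>j\<in>insert a I. (\<Sum>l\<in>UNIV. m' j l * v l) * \<phi>' j i) =
            v a * u i + (\<Sum>j\<in>I. (\<Sum>l\<in>UNIV. m' j l * v l) * \<phi>' j i)"
          using insert.hyps by (simp add: \<phi>'_def)
        also have "(\<Sum>j\<in>I. (\<Sum>l\<in>UNIV. m' j l * v l) * \<phi>' j i) =
            (\<Sum>j\<in>I. (\<Sum>l\<in>UNIV. m j l * w l) * \<phi> j i)"
        proof (rule sum.cong[OF refl])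
          fix j
          assume "j \<in> I"
          then have "j \<noteq> a"
            using insert.hyps by blast
          then show "(\<Sum>l\<in>UNIV. m' j l * v l) * \<phi>' j i = (\<Sum>l\<in>UNIV. m j l * w l) * \<phi> j i"
            by (simp add: coef \<phi>'_def)
        qed
        also have "\<dots> = w i"
          by (rule m[OF \<open>w \<in> S'\<close>, symmetric])
        finally show ?thesis
          by (simp add: w_def)
      qed
      moreover have "\<phi>' j \<in> S" for j
        using \<phi>[of j] u by (auto simp: \<phi>'_def S'_def)
      ultimately show ?thesis
        by blast
    qed
  qed
  from this[of UNIV] obtain \<phi> m where "\<forall>j. \<phi> j \<in> S"
    "\<forall>v\<in>S. \<forall>i. v i = (\<Sum>j\<in>UNIV. (\<Sum>l\<in>UNIV. m j l * v l) * \<phi> (j::'n) i)"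
    by auto
  then show ?thesis
    using that by blast
qed

text \<open>The pairing of G f with Theta e_j, with the symbol moved to the fixed side: in this form
  it is an inner product with a fixed vector and makes sense for L^2 functions \<open>f\<close>
  whose product with the symbol is not square integrable.\<close>

definition defect_coef :: "(real \<Rightarrow> 'n::finite \<Rightarrow> 'n \<Rightarrow> complex) \<Rightarrow> (real \<Rightarrow> 'n \<Rightarrow> 'n \<Rightarrow> complex)
    \<Rightarrow> (real \<Rightarrow> 'n \<Rightarrow> complex) \<Rightarrow> 'n \<Rightarrow> complex" where
  "defect_coef \<Theta> G f j = vinner f (mvadj G (mvmult \<Theta> (\<lambda>t. unit_vec j)))"

lemma mvmult_exp:
  "mvmult G (\<lambda>t i. exp (- \<i> * of_real t) * f t i) = (\<lambda>t i. exp (- \<i> * of_real t) * mvmult G f t i)"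
  by (simp add: mvmult_def fun_eq_iff sum_distrib_left mult.left_commute)

lemma vinner_exp_left: "vinner (\<lambda>t i. exp (- \<i> * of_real t) * F t i) w = vinner F (zmult w)"
proof -
  have "exp (- \<i> * of_real t) * F t i * cnj (w t i) = F t i * cnj (zmult w t i)" for t i
    by (simp only: zmult_def complex_cnj_mult cnj_exp_circ mult_ac)
  then show ?thesis
    by (simp only: vinner_def)
qed

lemma vLp_infinity_mvmult_const:
  assumes "mLp \<infinity> \<Theta>"
  shows "vLp \<infinity> (mvmult \<Theta> (\<lambda>t. c))"
proof -
  have "vLp \<infinity> (\<lambda>t i. \<Theta> t i j)" for j
    using assms by (simp add: mLp_def vLp_def)
  then show ?thesis
    using lin_closed_sum[OF lin_closed_vLp, of \<infinity> UNIV "\<lambda>j t i. \<Theta> t i j" c]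
    by (simp add: mvmult_def mult.commute)
qed

text \<open>Theta H^2 is the sum of Theta C^n and z Theta H^2, and \<open>zmult w\<close> is
  orthogonal to the second summand. What remains to be removed is its component along the functions
  \<open>mvmult \<Theta> (\<lambda>t. unit_vec j)\<close>, which are orthogonal and of squared norm
  \<open>2 * pi\<close>; hence the form of \<open>c\<close>.\<close>

lemma zmult_model_space_decomposition:
  fixes \<Theta> :: "real \<Rightarrow> 'n::finite \<Rightarrow> 'n \<Rightarrow> complex"
  assumes "matrix_inner \<Theta>" "w \<in> model_space \<Theta>"
  defines "c \<equiv> \<lambda>j. vinner (zmult w) (mvmult \<Theta> (\<lambda>t. unit_vec j)) / (2 * pi)"
  shows "(\<lambda>t i. zmult w t i - mvmult \<Theta> (\<lambda>t. c) t i) \<in> model_space \<Theta>"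
  unfolding model_space_def
proof (intro CollectI conjI allI impI)
  have w: "vHp 2 w"
    using assms by (simp add: model_space_def)
  have zw: "vHp 2 (zmult w)" and \<Theta>c: "vHp 2 (mvmult \<Theta> (\<lambda>t. c))" for c
    by (auto intro: vHp_zmult w vHp_mvmult_inner assms(1) vHp_const)
  show "vHp 2 (\<lambda>t i. zmult w t i - mvmult \<Theta> (\<lambda>t. c) t i)"
    by (intro lin_closed_diff[OF lin_closed_vHp] zw \<Theta>c) simp
  fix h :: "real \<Rightarrow> 'n \<Rightarrow> complex"
  assume h: "vHp 2 h"
  have bh: "vHp 2 (bshift h)"
    using h by (intro vHp_bshift) auto
  have \<Theta>bh: "vHp 2 (mvmult \<Theta> (bshift h))"
    by (intro vHp_mvmult_inner assms(1) bh)
  \<comment> \<open>Writing \<open>h\<close> as its value at 0 plus z times its backward shift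
    separates the two summands.\<close>
  have "mvmult \<Theta> h = mvmult \<Theta> (\<lambda>t i. val0 h i + 1 * zmult (bshift h) t i)"
    by (simp add: zmult_bshift)
  also have "\<dots> = (\<lambda>t i. mvmult \<Theta> (\<lambda>t. val0 h) t i + 1 * zmult (mvmult \<Theta> (bshift h)) t i)"
    unfolding mvmult_add_cmult mvmult_zmult ..
  finally have "vinner (zmult w) (mvmult \<Theta> h) =
      vinner (zmult w) (mvmult \<Theta> (\<lambda>t. val0 h)) + vinner (zmult w) (zmult (mvmult \<Theta> (bshift h)))"
    using vinner_add_cmult_right[of "zmult w" "mvmult \<Theta> (\<lambda>t. val0 h)" "zmult (mvmult \<Theta> (bshift h))" 1]
      zw \<Theta>c \<Theta>bh by (simp add: vHp_imp_vLp vLp_zmult)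
  also have "vinner (zmult w) (zmult (mvmult \<Theta> (bshift h))) = 0"
    using assms(2) bh by (simp add: vinner_zmult_zmult model_space_def)
  also have "vinner (zmult w) (mvmult \<Theta> (\<lambda>t. val0 h)) =
      (\<Sum>j\<in>UNIV. cnj (val0 h j) * vinner (zmult w) (mvmult \<Theta> (\<lambda>t. unit_vec j)))"
    unfolding mvmult_const[of \<Theta> "val0 h"] using zw \<Theta>c by (intro vinner_sum_right vHp_imp_vLp)
  also have "\<dots> = 2 * pi * (\<Sum>j\<in>UNIV. c j * cnj (val0 h j))"
    by (simp add: c_def sum_distrib_left mult.commute)
  also have "\<dots> = vinner (\<lambda>t. c) h"
    using h by (simp add: vinner_const_left vHp_imp_vLp)
  also have "\<dots> = vinner (mvmult \<Theta> (\<lambda>t. c)) (mvmult \<Theta> h)"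
    using h by (simp add: vinner_mvmult_inner assms(1) vLp_const vHp_imp_vLp)
  finally have "vinner (zmult w) (mvmult \<Theta> h) = vinner (mvmult \<Theta> (\<lambda>t. c)) (mvmult \<Theta> h)"
    by simp
  then show "vinner (\<lambda>t i. zmult w t i - mvmult \<Theta> (\<lambda>t. c) t i) (mvmult \<Theta> h) = 0"
    using zw \<Theta>c h vHp_mvmult_inner[OF assms(1) h] by (simp add: vinner_diff_left vHp_imp_vLp)
qed

lemma is_PK_bshift:
  fixes \<Theta> G :: "real \<Rightarrow> 'n::finite \<Rightarrow> 'n \<Rightarrow> complex"
  assumes inner: "matrix_inner \<Theta>" and G: "mLp 2 G" and f: "f \<in> mtto_dom \<Theta>" "val0 f = (\<lambda>i. 0)"
    and PK: "is_PK \<Theta> (mvmult G f) v"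
  shows "is_PK \<Theta> (mvmult G (bshift f)) (\<lambda>t i. bshift v t i +
    (\<Sum>j\<in>UNIV. (defect_coef \<Theta> G f j / (2 * pi)) * bshift (mvmult \<Theta> (\<lambda>t. unit_vec j)) t i))"
proof -
  define D where "D = (\<lambda>t i. \<Sum>j\<in>UNIV. (defect_coef \<Theta> G f j / (2 * pi)) *
      bshift (mvmult \<Theta> (\<lambda>t. unit_vec j)) t i)"
  have v: "v \<in> model_space \<Theta>"
    using PK by (simp add: is_PK_def)
  have bv: "bshift v \<in> model_space \<Theta>"
    by (intro bshift_model_space inner v)
  have D: "D \<in> model_space \<Theta>"
    unfolding D_def
    by (rule lin_closed_sum[OF lin_closed_model_space[OF inner]], rule bshift_inner_model_space[OF inner])
  have sum: "(\<lambda>t i. bshift v t i + D t i) \<in> model_space \<Theta>"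
    using lin_closed_add_cmult[OF lin_closed_model_space[OF inner], of "bshift v" D 1] bv D by simp
  have "vHp \<infinity> f"
    using f(1) by (simp add: mtto_dom_def)
  then have Gf: "vLp 2 (mvmult G f)" and Gbf: "vLp 2 (mvmult G (bshift f))"
    by (simp_all add: vLp_mvmult_bounded_right G vHp_imp_vLp vHp_bshift)
  have \<Theta>c: "vHp 2 (mvmult \<Theta> (\<lambda>t. c))" for c
    by (auto intro: vHp_mvmult_inner inner vHp_const)
  have "vinner (\<lambda>t i. mvmult G (bshift f) t i - (bshift v t i + D t i)) w = 0"
    if w: "w \<in> model_space \<Theta>" for w
  proof -
    from w have w2: "vHp 2 w" and zw: "vHp 2 (zmult w)"
      by (auto simp: model_space_def intro: vHp_zmult)
    define c where "c j = vinner (zmult w) (mvmult \<Theta> (\<lambda>t. unit_vec j)) / (2 * pi)" for j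
    define u where "u = (\<lambda>t i. zmult w t i - mvmult \<Theta> (\<lambda>t. c) t i)"
    have u: "u \<in> model_space \<Theta>"
      using zmult_model_space_decomposition[OF inner w] by (simp add: u_def c_def[abs_def])
    have zw_eq: "zmult w = (\<lambda>t i. u t i + 1 * mvmult \<Theta> (\<lambda>t. c) t i)"
      by (simp add: u_def)
    have split: "vinner F (zmult w) = vinner F u + vinner F (mvmult \<Theta> (\<lambda>t. c))" if "vLp 2 F" for F
      unfolding zw_eq using vinner_add_cmult_right[OF that model_space_vLp[OF u] vHp_imp_vLp[OF \<Theta>c], of 1]
      by simp
    have "vinner (mvmult G (bshift f)) w = vinner (mvmult G f) (zmult w)"
      unfolding bshift_eq_if_val0_eq_0[OF f(2)] mvmult_exp vinner_exp_left ..
    also have "\<dots> = vinner (mvmult G f) u + vinner (mvmult G f) (mvmult \<Theta> (\<lambda>t. c))"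
      by (rule split[OF Gf])
    \<comment> \<open>On \<open>u\<close>, an element of the model space, \<open>mvmult G f\<close>
      may be replaced by its projection \<open>v\<close>.\<close>
    also have "vinner (mvmult G f) u = vinner v u"
      using PK u Gf model_space_vLp[OF u] model_space_vLp[OF v]
      by (auto simp: is_PK_def vinner_diff_left)
    \<comment> \<open>\<open>v\<close> is orthogonal to Theta c, so the removed component may be put
      back.\<close>
    also have "\<dots> = vinner v (zmult w)"
      using split[OF model_space_vLp[OF v]] v vHp_const[of 2 c] by (simp add: model_space_def)
    also have "\<dots> = vinner (bshift v) w"
      by (intro vinner_bshift[symmetric] model_space_vHp[OF v] w2)
    \<comment> \<open>The component along Theta c is invisible to the projection and produces the
      correction terms.\<close>
    also have "vinner (mvmult G f) (mvmult \<Theta> (\<lambda>t. c)) =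
        (\<Sum>j\<in>UNIV. cnj (c j) * defect_coef \<Theta> G f j)"
      unfolding mvmult_const[of \<Theta> c] defect_coef_def vinner_mvmult_left[symmetric]
      by (intro vinner_sum_right Gf vHp_imp_vLp[OF \<Theta>c])
    also have "\<dots> = (\<Sum>j\<in>UNIV. (defect_coef \<Theta> G f j / (2 * pi)) *
        vinner (bshift (mvmult \<Theta> (\<lambda>t. unit_vec j))) w)"
    proof (rule sum.cong[OF refl])
      fix j
      \<comment> \<open>The conjugated coefficients of \<open>zmult w\<close> are pairings of
        backward shifts with \<open>w\<close>, which makes the sum an inner product with
        \<open>D\<close>.\<close>
      have "vinner (bshift (mvmult \<Theta> (\<lambda>t. unit_vec j))) w =
          cnj (vinner (zmult w) (mvmult \<Theta> (\<lambda>t. unit_vec j)))"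
        unfolding vinner_bshift[OF \<Theta>c w2] by (rule vinner_commute)
      then show "cnj (c j) * defect_coef \<Theta> G f j = (defect_coef \<Theta> G f j / (2 * pi)) *
          vinner (bshift (mvmult \<Theta> (\<lambda>t. unit_vec j))) w"
        by (simp add: c_def)
    qed
    also have "\<dots> = vinner D w"
      unfolding D_def
      by (rule vinner_sum_left[symmetric, OF vHp_imp_vLp[OF w2]],
          rule model_space_vLp[OF bshift_inner_model_space[OF inner]])
    also have "vinner (bshift v) w + vinner D w = vinner (\<lambda>t i. bshift v t i + D t i) w"
      using vinner_add_cmult_left[OF model_space_vLp[OF bv] model_space_vLp[OF D] vHp_imp_vLp[OF w2], of 1]
      by simp
    finally show "vinner (\<lambda>t i. mvmult G (bshift f) t i - (bshift v t i + D t i)) w = 0"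
      using vinner_diff_left[OF Gbf model_space_vLp[OF sum] vHp_imp_vLp[OF w2]] by simp
  qed
  with sum show ?thesis
    unfolding D_def is_PK_def by blast
qed

subsection \<open>Convergence in mean square\<close>

text \<open>It has the same null sequences as \<open>vnorm2\<close> and spares the limit arguments
  the square roots.\<close>

definition sqnorm :: "(real \<Rightarrow> 'n::finite \<Rightarrow> complex) \<Rightarrow> real" where
  "sqnorm F = (\<integral>t. (\<Sum>i\<in>UNIV. (cmod (F t i))\<^sup>2) \<partial>circ)"

lemma sqnorm_nonneg: "sqnorm F \<ge> 0"
  unfolding sqnorm_def by (intro Bochner_Integration.integral_nonneg sum_nonneg) auto

lemma vnorm2_eq: "vnorm2 F = sqrt (sqnorm F)"
  by (simp add: vnorm2_def sqnorm_def)

lemma vnorm2_tendsto_0_iff: "(\<lambda>k. vnorm2 (F k)) \<longlonglongrightarrow> 0 \<longleftrightarrow> (\<lambda>k. sqnorm (F k)) \<longlonglongrightarrow> 0"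
proof
  assume "(\<lambda>k. vnorm2 (F k)) \<longlonglongrightarrow> 0"
  from tendsto_power[OF this, of 2] show "(\<lambda>k. sqnorm (F k)) \<longlonglongrightarrow> 0"
    by (simp only: vnorm2_eq real_sqrt_pow2[OF sqnorm_nonneg] zero_power2)
next
  assume "(\<lambda>k. sqnorm (F k)) \<longlonglongrightarrow> 0"
  from tendsto_real_sqrt[OF this] show "(\<lambda>k. vnorm2 (F k)) \<longlonglongrightarrow> 0"
    by (simp add: vnorm2_eq)
qed

lemma sqnorm_integrable:
  assumes "vLp 2 F"
  shows "integrable circ (\<lambda>t. (cmod (F t i))\<^sup>2)"
  using assms by (simp add: vLp_def Lp_circ_2_iff)

lemma sqnorm_component_le:
  assumes "vLp 2 F"
  shows "(\<integral>t. (cmod (F t i))\<^sup>2 \<partial>circ) \<le> sqnorm F"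
  unfolding sqnorm_def
  by (intro integral_mono Bochner_Integration.integrable_sum sqnorm_integrable assms member_le_sum) auto

lemma sqnorm_add_cmult_le:
  assumes "vLp 2 F" "vLp 2 H"
  shows "sqnorm (\<lambda>t i. F t i + c * H t i) \<le> 2 * sqnorm F + 2 * (cmod c)\<^sup>2 * sqnorm H"
proof -
  have FH: "vLp 2 (\<lambda>t i. F t i + c * H t i)"
    using assms by (simp add: lin_closed_add_cmult[OF lin_closed_vLp])
  have "sqnorm (\<lambda>t i. F t i + c * H t i) \<le>
      (\<integral>t. 2 * (\<Sum>i\<in>UNIV. (cmod (F t i))\<^sup>2) + 2 * (cmod c)\<^sup>2 * (\<Sum>i\<in>UNIV. (cmod (H t i))\<^sup>2) \<partial>circ)"
    unfolding sqnorm_def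
  proof (rule integral_mono)
    show "integrable circ (\<lambda>t. \<Sum>i\<in>UNIV. (cmod (F t i + c * H t i))\<^sup>2)"
      using sqnorm_integrable[OF FH] by simp
    show "integrable circ (\<lambda>t. 2 * (\<Sum>i\<in>UNIV. (cmod (F t i))\<^sup>2) +
        2 * (cmod c)\<^sup>2 * (\<Sum>i\<in>UNIV. (cmod (H t i))\<^sup>2))"
      using sqnorm_integrable[OF assms(1)] sqnorm_integrable[OF assms(2)] by simp
    fix t
    have "(\<Sum>i\<in>UNIV. (cmod (F t i + c * H t i))\<^sup>2) \<le>
        (\<Sum>i\<in>UNIV. 2 * (cmod (F t i))\<^sup>2 + 2 * (cmod (c * H t i))\<^sup>2)"
      by (intro sum_mono cmod_add_squared_le)
    then show "(\<Sum>i\<in>UNIV. (cmod (F t i + c * H t i))\<^sup>2) \<le>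
        2 * (\<Sum>i\<in>UNIV. (cmod (F t i))\<^sup>2) + 2 * (cmod c)\<^sup>2 * (\<Sum>i\<in>UNIV. (cmod (H t i))\<^sup>2)"
      by (simp add: sum.distrib sum_distrib_left norm_mult power_mult_distrib mult.assoc)
  qed
  also have "\<dots> = 2 * sqnorm F + 2 * (cmod c)\<^sup>2 * sqnorm H"
    unfolding sqnorm_def
    using sqnorm_integrable[OF assms(1)] sqnorm_integrable[OF assms(2)] by simp
  finally show ?thesis .
qed

lemma sqnorm_add_cmult_tendsto_0:
  assumes "\<And>k. vLp 2 (F k)" "\<And>k. vLp 2 (H k)"
    and "(\<lambda>k. sqnorm (F k)) \<longlonglongrightarrow> 0" "(\<lambda>k. (cmod (c k))\<^sup>2 * sqnorm (H k)) \<longlonglongrightarrow> 0"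
  shows "(\<lambda>k. sqnorm (\<lambda>t i. F k t i + c k * H k t i)) \<longlonglongrightarrow> 0"
proof (rule tendsto_sandwich[of "\<lambda>k. 0"])
  have "(\<lambda>k. 2 * sqnorm (F k) + 2 * ((cmod (c k))\<^sup>2 * sqnorm (H k))) \<longlonglongrightarrow> 2 * 0 + 2 * 0"
    by (intro tendsto_intros assms)
  then show "(\<lambda>k. 2 * sqnorm (F k) + 2 * ((cmod (c k))\<^sup>2 * sqnorm (H k))) \<longlonglongrightarrow> 0"
    by simp
  show "\<forall>\<^sub>F k in sequentially. sqnorm (\<lambda>t i. F k t i + c k * H k t i) \<le>
      2 * sqnorm (F k) + 2 * ((cmod (c k))\<^sup>2 * sqnorm (H k))"
    using sqnorm_add_cmult_le[OF assms(1,2)] by (simp add: mult.assoc)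
qed (auto simp: sqnorm_nonneg)

text \<open>The vectors \<open>x j\<close> are fixed while the coefficients tend to 0; this is how
  the correction terms below disappear in the limit.\<close>

lemma sqnorm_lincomb_tendsto_0:
  assumes "\<And>k. vLp 2 (F k)" "\<And>j. vLp 2 (x j)"
    and "(\<lambda>k. sqnorm (F k)) \<longlonglongrightarrow> 0" "\<And>j. (\<lambda>k. c k j) \<longlonglongrightarrow> 0"
  shows "(\<lambda>k. sqnorm (\<lambda>t i. F k t i + (\<Sum>j\<in>A. c k j * x j t i))) \<longlonglongrightarrow> 0"
proof (induction A rule: infinite_finite_induct)
  case (insert a A)
  have "(\<lambda>k. sqnorm (\<lambda>t i. (F k t i + (\<Sum>j\<in>A. c k j * x j t i)) + c k a * x a t i)) \<longlonglongrightarrow> 0"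
  proof (rule sqnorm_add_cmult_tendsto_0)
    show "vLp 2 (\<lambda>t i. F k t i + (\<Sum>j\<in>A. c k j * x j t i))" for k
      using lin_closed_add_cmult[OF lin_closed_vLp[of 2], of "F k" "\<lambda>t i. \<Sum>j\<in>A. c k j * x j t i" 1]
        lin_closed_sum[OF lin_closed_vLp[of 2], of A x "c k"] assms(1,2) by simp
    have "(\<lambda>k. (cmod (c k a))\<^sup>2 * sqnorm (x a)) \<longlonglongrightarrow> (cmod 0)\<^sup>2 * sqnorm (x a)"
      by (intro tendsto_intros assms)
    then show "(\<lambda>k. (cmod (c k a))\<^sup>2 * sqnorm (x a)) \<longlonglongrightarrow> 0"
      by simp
  qed (use insert assms in auto)
  then show ?case
    using insert.hyps by (simp add: algebra_simps)
qed (use assms in auto)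

lemma vinner_tendsto_0:
  assumes "\<And>k. vLp 2 (F k)" "vLp 2 H" "(\<lambda>k. sqnorm (F k)) \<longlonglongrightarrow> 0"
  shows "(\<lambda>k. vinner (F k) H) \<longlonglongrightarrow> 0"
proof -
  have "(\<lambda>k. \<integral>t. F k t i * cnj (H t i) \<partial>circ) \<longlonglongrightarrow> 0" for i
  proof (rule integral_mult_tendsto_0)
    show "Lp_circ 2 (\<lambda>t. cnj (H t i))" "Lp_circ 2 (\<lambda>t. F k t i)" for k
      using assms by (auto simp: vLp_def Lp_circ_2_cnj)
    show "(\<lambda>k. \<integral>t. (cmod (F k t i))\<^sup>2 \<partial>circ) \<longlonglongrightarrow> 0"
      using assms by (intro tendsto_sandwich[OF _ _ tendsto_const assms(3)])
        (auto simp: sqnorm_component_le)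
  qed
  then have "(\<lambda>k. \<Sum>i\<in>UNIV. \<integral>t. F k t i * cnj (H t i) \<partial>circ) \<longlonglongrightarrow> 0"
    by (intro tendsto_null_sum)
  then show ?thesis
    using assms by (simp add: vinner_eq_sum)
qed

section \<open>Value at 0, backward shift and defect coefficients\<close>

lemma val0_eq_vinner:
  assumes "vLp 2 F"
  shows "val0 F j = vinner F (\<lambda>t. unit_vec j) / (2 * pi)"
proof -
  have "vinner F (\<lambda>t. unit_vec j) = cnj (2 * pi * (\<Sum>i\<in>UNIV. unit_vec j i * cnj (val0 F i)))"
    using vinner_const_left[OF assms] by (subst vinner_commute) simp
  then show ?thesis
    by (simp add: unit_vec_def if_distrib[of "\<lambda>x. x * _"] cong: if_cong)
qed

lemma val0_add_cmult:
  assumes "vLp 2 f" "vLp 2 g"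
  shows "val0 (\<lambda>t i. f t i + c * g t i) j = val0 f j + c * val0 g j"
  using assms by (simp add: val0_def fcoef_add_cmult vLp_def)

lemma val0_sum:
  assumes "\<And>j. vLp 2 (x j)"
  shows "val0 (\<lambda>t i. \<Sum>j\<in>A. c j * x j t i) l = (\<Sum>j\<in>A. c j * val0 (x j) l)"
  using lin_closed_sum[OF lin_closed_vLp[of 2], of A x c] assms
  by (simp add: val0_eq_vinner vinner_sum_left vLp_const sum_divide_distrib)

lemma val0_tendsto_0:
  assumes "\<And>k. vLp 2 (F k)" "(\<lambda>k. sqnorm (F k)) \<longlonglongrightarrow> 0"
  shows "(\<lambda>k. val0 (F k) j) \<longlonglongrightarrow> 0"
  using tendsto_divide_zero[OF vinner_tendsto_0[OF assms(1) vLp_const assms(2)]]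
  by (simp add: val0_eq_vinner assms(1))

lemma sqnorm_unimodular_mult:
  "(\<And>t. cmod (e t) = 1) \<Longrightarrow> sqnorm (\<lambda>t i. e t * F t i) = sqnorm F"
  by (simp add: sqnorm_def norm_mult)

text \<open>Up to a unimodular factor the backward shift subtracts the constant
  \<open>val0 (F k)\<close>, which tends to 0 together with \<open>F k\<close>.\<close>

lemma sqnorm_bshift_tendsto_0:
  assumes "\<And>k. vLp 2 (F k)" "(\<lambda>k. sqnorm (F k)) \<longlonglongrightarrow> 0"
  shows "(\<lambda>k. sqnorm (bshift (F k))) \<longlonglongrightarrow> 0"
proof -
  have "sqnorm (bshift (F k)) = sqnorm (\<lambda>t i. F k t i + (\<Sum>j\<in>UNIV. - val0 (F k) j * unit_vec j i))" for k
  proof -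
    have "sqnorm (bshift (F k)) = sqnorm (zmult (bshift (F k)))"
      unfolding zmult_def by (rule sqnorm_unimodular_mult[symmetric]) simp
    also have "\<dots> = sqnorm (\<lambda>t i. F k t i + (\<Sum>j\<in>UNIV. - val0 (F k) j * unit_vec j i))"
      unfolding zmult_bshift
      by (simp add: unit_vec_def if_distrib[of "\<lambda>x. _ * x"] cong: if_cong)
    finally show ?thesis .
  qed
  moreover have "(\<lambda>k. sqnorm (\<lambda>t i. F k t i +
      (\<Sum>j\<in>UNIV. - val0 (F k) j * (\<lambda>j t. unit_vec j) j t i))) \<longlonglongrightarrow> 0"
    using tendsto_minus[OF val0_tendsto_0[OF assms]]
    by (intro sqnorm_lincomb_tendsto_0 assms vLp_const) simp
  ultimately show ?thesis
    by simp
qed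

lemma defect_coef_add_cmult:
  assumes "matrix_inner \<Theta>" "mLp 2 G" "vLp 2 f" "vLp 2 g"
  shows "defect_coef \<Theta> G (\<lambda>t i. f t i + c * g t i) j = defect_coef \<Theta> G f j + c * defect_coef \<Theta> G g j"
  unfolding defect_coef_def using assms
  by (intro vinner_add_cmult_left vLp_mvadj vLp_infinity_mvmult_const matrix_inner_mLp)

lemma defect_coef_sum:
  assumes "matrix_inner \<Theta>" "mLp 2 G" "\<And>j. vLp 2 (x j)"
  shows "defect_coef \<Theta> G (\<lambda>t i. \<Sum>j\<in>A. c j * x j t i) l = (\<Sum>j\<in>A. c j * defect_coef \<Theta> G (x j) l)"
  unfolding defect_coef_def using assms
  by (intro vinner_sum_left vLp_mvadj vLp_infinity_mvmult_const matrix_inner_mLp)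

subsection \<open>Kernels\<close>

locale bounded_mtto =
  fixes \<Theta> G :: "real \<Rightarrow> 'n::finite \<Rightarrow> 'n \<Rightarrow> complex"
  assumes inner: "matrix_inner \<Theta>" and symbol: "mLp 2 G" and bounded: "is_MTTO \<Theta> G"
begin

text \<open>The operator on its domain as a relation: \<open>is_PK\<close> fixes the image only up
  to null sets, and carrying the image along with the argument leaves no existence of projections to
  be proved.\<close>

definition mtto_graph :: "(real \<Rightarrow> 'n \<Rightarrow> complex) \<Rightarrow> (real \<Rightarrow> 'n \<Rightarrow> complex) \<Rightarrow> bool" where
  "mtto_graph f v \<longleftrightarrow> f \<in> mtto_dom \<Theta> \<and> is_PK \<Theta> (mvmult G f) v"

definition approximable :: "(real \<Rightarrow> 'n \<Rightarrow> complex) \<Rightarrow> bool" where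
  "approximable f \<longleftrightarrow> (\<exists>fs vs. (\<forall>k. mtto_graph (fs k) (vs k)) \<and>
     (\<lambda>k. sqnorm (\<lambda>t i. fs k t i - f t i)) \<longlonglongrightarrow> 0)"

text \<open>The kernel condition with one sequence in place of all of them, so that sums and
  corrected sequences can be built explicitly. By \<open>null_lim_imp_ker\<close> and
  \<open>ker_imp_null_lim\<close> it agrees with membership in the kernel on approximable
  elements.\<close>

definition null_lim :: "(real \<Rightarrow> 'n \<Rightarrow> complex) \<Rightarrow> bool" where
  "null_lim f \<longleftrightarrow> f \<in> model_space \<Theta> \<and> (\<exists>fs vs. (\<forall>k. mtto_graph (fs k) (vs k)) \<and>
     (\<lambda>k. sqnorm (\<lambda>t i. fs k t i - f t i)) \<longlonglongrightarrow> 0 \<and> (\<lambda>k. sqnorm (vs k)) \<longlonglongrightarrow> 0)"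

lemma mtto_graph_vLp:
  assumes "mtto_graph f v"
  shows "vLp 2 f" "vLp 2 v" "vLp 2 (mvmult G f)"
  using assms symbol
  by (auto simp: mtto_graph_def mtto_dom_def is_PK_def intro: model_space_vLp
      vLp_mvmult_bounded_right vHp_imp_vLp)

lemma mtto_graph_add_cmult:
  assumes "mtto_graph f v" "mtto_graph g w"
  shows "mtto_graph (\<lambda>t i. f t i + c * g t i) (\<lambda>t i. v t i + c * w t i)"
  using is_PK_add_cmult[OF inner, of "mvmult G f" "mvmult G g" v w c] assms
    lin_closed_add_cmult[OF lin_closed_mtto_dom[OF inner], of f g c] mtto_graph_vLp
  by (auto simp: mtto_graph_def mvmult_add_cmult)

lemma mtto_graph_0: "mtto_graph (\<lambda>t i. 0) (\<lambda>t i. 0)"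
proof -
  have "mvmult G (\<lambda>t i. 0) = (\<lambda>t i. 0)"
    by (simp add: mvmult_def)
  then show ?thesis
    using lin_closed_0[OF lin_closed_mtto_dom[OF inner]] lin_closed_0[OF lin_closed_model_space[OF inner]]
    by (simp add: mtto_graph_def is_PK_def)
qed

lemma mtto_graph_sum:
  assumes "\<And>j. mtto_graph (x j) (y j)"
  shows "mtto_graph (\<lambda>t i. \<Sum>j\<in>A. c j * x j t i) (\<lambda>t i. \<Sum>j\<in>A. c j * y j t i)"
proof (induction A rule: infinite_finite_induct)
  case (insert a A)
  from mtto_graph_add_cmult[OF insert.IH assms[of a], of "c a"] show ?case
    using insert.hyps by (simp add: add.commute)
qed (use mtto_graph_0 in auto)

text \<open>Squaring the estimate of \<open>is_MTTO\<close> yields a constant that is nonnegative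
  whatever the sign of the original one.\<close>

lemma mtto_graph_bound:
  obtains C where "C \<ge> 0" "\<And>f v. mtto_graph f v \<Longrightarrow> sqnorm v \<le> C * sqnorm f"
proof -
  obtain C where C: "\<And>f v. mtto_graph f v \<Longrightarrow> sqrt (sqnorm v) \<le> C * sqrt (sqnorm f)"
    using bounded by (auto simp: is_MTTO_def mtto_graph_def vnorm2_eq)
  have "sqnorm v \<le> C\<^sup>2 * sqnorm f" if "mtto_graph f v" for f v
  proof -
    have "(sqrt (sqnorm v))\<^sup>2 \<le> (C * sqrt (sqnorm f))\<^sup>2"
      using C[OF that] by (intro power_mono) (auto simp: sqnorm_nonneg)
    then show ?thesis
      by (simp add: sqnorm_nonneg power_mult_distrib)
  qed
  then show ?thesis
    using that[of "C\<^sup>2"] by simp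
qed

lemma null_lim_model_space: "null_lim f \<Longrightarrow> f \<in> model_space \<Theta>"
  by (simp add: null_lim_def)

lemma null_lim_vLp: "null_lim f \<Longrightarrow> vLp 2 f"
  using null_lim_model_space model_space_vLp by blast

lemma lin_closed_null_lim: "lin_closed null_lim"
  unfolding lin_closed_def
proof (intro conjI allI impI)
  have "sqnorm (\<lambda>t (i::'n). 0) = 0"
    by (simp add: sqnorm_def)
  then show "null_lim (\<lambda>t i. 0)"
    unfolding null_lim_def
    using mtto_graph_0 lin_closed_0[OF lin_closed_model_space[OF inner]]
    by (intro conjI exI[of _ "\<lambda>k t i. 0"]) auto
  fix f g c
  assume f: "null_lim f" and g: "null_lim g"
  obtain fs vs where fs: "\<And>k. mtto_graph (fs k) (vs k)"
    "(\<lambda>k. sqnorm (\<lambda>t i. fs k t i - f t i)) \<longlonglongrightarrow> 0" "(\<lambda>k. sqnorm (vs k)) \<longlonglongrightarrow> 0"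
    using f by (auto simp: null_lim_def)
  obtain gs ws where gs: "\<And>k. mtto_graph (gs k) (ws k)"
    "(\<lambda>k. sqnorm (\<lambda>t i. gs k t i - g t i)) \<longlonglongrightarrow> 0" "(\<lambda>k. sqnorm (ws k)) \<longlonglongrightarrow> 0"
    using g by (auto simp: null_lim_def)
  have K: "(\<lambda>t i. f t i + c * g t i) \<in> model_space \<Theta>"
    using lin_closed_add_cmult[OF lin_closed_model_space[OF inner], of f g c] f g
    by (simp add: null_lim_model_space)
  have lim0: "(\<lambda>k. (cmod c)\<^sup>2 * h k) \<longlonglongrightarrow> 0" if "h \<longlonglongrightarrow> 0" for h
    using tendsto_mult_right_zero[OF that] .
  have v: "(\<lambda>k. sqnorm (\<lambda>t i. vs k t i + c * ws k t i)) \<longlonglongrightarrow> 0"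
    using fs gs lim0 by (intro sqnorm_add_cmult_tendsto_0) (auto intro: mtto_graph_vLp)
  have "vLp 2 (\<lambda>t i. fs k t i - f t i)" "vLp 2 (\<lambda>t i. gs k t i - g t i)" for k
    using lin_closed_diff[OF lin_closed_vLp[of 2], of "fs k" f]
      lin_closed_diff[OF lin_closed_vLp[of 2], of "gs k" g]
      mtto_graph_vLp[OF fs(1)] mtto_graph_vLp[OF gs(1)] null_lim_vLp f g by auto
  then have "(\<lambda>k. sqnorm (\<lambda>t i. (fs k t i - f t i) + c * (gs k t i - g t i))) \<longlonglongrightarrow> 0"
    using fs(2) gs(2) lim0 by (intro sqnorm_add_cmult_tendsto_0) auto
  moreover have "(\<lambda>t i. (fs k t i - f t i) + c * (gs k t i - g t i)) =
      (\<lambda>t i. fs k t i + c * gs k t i - (f t i + c * g t i))" for k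
    by (simp add: fun_eq_iff algebra_simps)
  ultimately have "(\<lambda>k. sqnorm (\<lambda>t i. fs k t i + c * gs k t i - (f t i + c * g t i))) \<longlonglongrightarrow> 0"
    by simp
  then show "null_lim (\<lambda>t i. f t i + c * g t i)"
    unfolding null_lim_def using K v mtto_graph_add_cmult[OF fs(1) gs(1)]
    by (intro conjI exI[of _ "\<lambda>k t i. fs k t i + c * gs k t i"]
        exI[of _ "\<lambda>k t i. vs k t i + c * ws k t i"]) auto
qed

lemma MTTO_ker_iff:
  "f \<in> MTTO_ker \<Theta> G \<longleftrightarrow> f \<in> model_space \<Theta> \<and>
     (\<forall>fs vs. (\<forall>k. mtto_graph (fs k) (vs k)) \<longrightarrow>
        (\<lambda>k. sqnorm (\<lambda>t i. fs k t i - f t i)) \<longlonglongrightarrow> 0 \<longrightarrow> (\<lambda>k. sqnorm (vs k)) \<longlonglongrightarrow> 0)"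
  by (simp add: MTTO_ker_def MTTO_ext_def mtto_graph_def vnorm2_tendsto_0_iff)

text \<open>The defining condition ranges over approximating sequences and holds vacuously.\<close>

lemma not_approximable_imp_ker:
  "f \<in> model_space \<Theta> \<Longrightarrow> \<not> approximable f \<Longrightarrow> f \<in> MTTO_ker \<Theta> G"
  by (auto simp: MTTO_ker_iff approximable_def)

text \<open>Serves to show that an approximable element minus a non-approximable one is never
  approximable.\<close>

lemma approximable_diff:
  assumes "f \<in> model_space \<Theta>" "g \<in> model_space \<Theta>" "approximable f" "approximable g"
  shows "approximable (\<lambda>t i. f t i - g t i)"
proof -
  obtain fs vs where fs: "\<And>k. mtto_graph (fs k) (vs k)"
    "(\<lambda>k. sqnorm (\<lambda>t i. fs k t i - f t i)) \<longlonglongrightarrow> 0"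
    using assms by (auto simp: approximable_def)
  obtain gs ws where gs: "\<And>k. mtto_graph (gs k) (ws k)"
    "(\<lambda>k. sqnorm (\<lambda>t i. gs k t i - g t i)) \<longlonglongrightarrow> 0"
    using assms by (auto simp: approximable_def)
  have "vLp 2 (\<lambda>t i. fs k t i - f t i)" "vLp 2 (\<lambda>t i. gs k t i - g t i)" for k
    using lin_closed_diff[OF lin_closed_vLp[of 2], of "fs k" f]
      lin_closed_diff[OF lin_closed_vLp[of 2], of "gs k" g]
      mtto_graph_vLp[OF fs(1)] mtto_graph_vLp[OF gs(1)] assms(1,2)[THEN model_space_vLp] by auto
  then have "(\<lambda>k. sqnorm (\<lambda>t i. (fs k t i - f t i) + (-1) * (gs k t i - g t i))) \<longlonglongrightarrow> 0"
    using fs(2) gs(2) by (intro sqnorm_add_cmult_tendsto_0) auto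
  moreover have "(\<lambda>t i. (fs k t i - f t i) + (-1) * (gs k t i - g t i)) =
      (\<lambda>t i. fs k t i + (-1) * gs k t i - (f t i - g t i))" for k
    by (simp add: fun_eq_iff algebra_simps)
  ultimately have "(\<lambda>k. sqnorm (\<lambda>t i. fs k t i + (-1) * gs k t i - (f t i - g t i))) \<longlonglongrightarrow> 0"
    by simp
  then show ?thesis
    unfolding approximable_def
    by (intro exI[of _ "\<lambda>k t i. fs k t i + (-1) * gs k t i"]
        exI[of _ "\<lambda>k t i. vs k t i + (-1) * ws k t i"] conjI allI mtto_graph_add_cmult fs(1) gs(1))
qed

text \<open>Two sequences with the same limit differ by a null sequence in the domain, which
  boundedness sends to a null sequence. Hence one sequence with images tending to 0 forces the same
  for all.\<close>

lemma null_lim_imp_ker: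
  assumes "null_lim f"
  shows "f \<in> MTTO_ker \<Theta> G"
  unfolding MTTO_ker_iff
proof (intro conjI allI impI)
  show "f \<in> model_space \<Theta>"
    using assms by (rule null_lim_model_space)
  obtain fs vs where fs: "\<And>k. mtto_graph (fs k) (vs k)"
    "(\<lambda>k. sqnorm (\<lambda>t i. fs k t i - f t i)) \<longlonglongrightarrow> 0" "(\<lambda>k. sqnorm (vs k)) \<longlonglongrightarrow> 0"
    using assms by (auto simp: null_lim_def)
  fix gs ws
  assume gs': "\<forall>k. mtto_graph (gs k) (ws k)" and
    gs_lim: "(\<lambda>k. sqnorm (\<lambda>t i. gs k t i - f t i)) \<longlonglongrightarrow> 0"
  from gs' have gs: "mtto_graph (gs k) (ws k)" for k
    by blast
  obtain C where C: "C \<ge> 0" "\<And>f v. mtto_graph f v \<Longrightarrow> sqnorm v \<le> C * sqnorm f"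
    by (rule mtto_graph_bound) blast
  have L: "vLp 2 (\<lambda>t i. fs k t i - f t i)" "vLp 2 (\<lambda>t i. gs k t i - f t i)" for k
    using lin_closed_diff[OF lin_closed_vLp[of 2], of "fs k" f]
      lin_closed_diff[OF lin_closed_vLp[of 2], of "gs k" f]
      mtto_graph_vLp[OF fs(1)] mtto_graph_vLp[OF gs] null_lim_vLp[OF assms] by auto
  then have "(\<lambda>k. sqnorm (\<lambda>t i. (gs k t i - f t i) + (-1) * (fs k t i - f t i))) \<longlonglongrightarrow> 0"
    using fs(2) gs_lim by (intro sqnorm_add_cmult_tendsto_0) auto
  moreover have "(\<lambda>t i. (gs k t i - f t i) + (-1) * (fs k t i - f t i)) =
      (\<lambda>t i. gs k t i + (-1) * fs k t i)" for k
    by (simp add: fun_eq_iff)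
  ultimately have diff0: "(\<lambda>k. sqnorm (\<lambda>t i. gs k t i + (-1) * fs k t i)) \<longlonglongrightarrow> 0"
    by simp
  have lim: "(\<lambda>k. sqnorm (\<lambda>t i. ws k t i + (-1) * vs k t i)) \<longlonglongrightarrow> 0"
  proof (rule tendsto_sandwich[OF _ _ tendsto_const])
    show "(\<lambda>k. C * sqnorm (\<lambda>t i. gs k t i + (-1) * fs k t i)) \<longlonglongrightarrow> 0"
      by (rule tendsto_mult_right_zero[OF diff0])
    show "\<forall>\<^sub>F k in sequentially. sqnorm (\<lambda>t i. ws k t i + (-1) * vs k t i) \<le>
        C * sqnorm (\<lambda>t i. gs k t i + (-1) * fs k t i)"
      using C(2)[OF mtto_graph_add_cmult[OF gs fs(1)]] by (intro always_eventually allI)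
  qed (auto simp: sqnorm_nonneg)
  have "(\<lambda>k. (cmod 1)\<^sup>2 * sqnorm (vs k)) \<longlonglongrightarrow> 0"
    using fs(3) by simp
  from sqnorm_add_cmult_tendsto_0[OF mtto_graph_vLp(2)[OF mtto_graph_add_cmult[OF gs fs(1)]]
      mtto_graph_vLp(2)[OF fs(1)] lim this]
  show "(\<lambda>k. sqnorm (ws k)) \<longlonglongrightarrow> 0"
    by simp
qed

lemma ker_imp_null_lim:
  "f \<in> MTTO_ker \<Theta> G \<Longrightarrow> approximable f \<Longrightarrow> null_lim f"
  unfolding MTTO_ker_iff approximable_def null_lim_def by blast

text \<open>The approximating sequence is first corrected by finitely many fixed elements of the
  domain so that its members vanish at \<open>0\<close>, like \<open>f\<close> itself.\<close>

lemma null_lim_vanishing_approximation: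
  assumes "null_lim f" "val0 f = (\<lambda>i. 0)"
  obtains fs vs where "\<And>k. mtto_graph (fs k) (vs k)" "\<And>k. val0 (fs k) = (\<lambda>i. 0)"
    "(\<lambda>k. sqnorm (\<lambda>t i. fs k t i - f t i)) \<longlonglongrightarrow> 0" "(\<lambda>k. sqnorm (vs k)) \<longlonglongrightarrow> 0"
proof -
  obtain fs vs where fs: "\<And>k. mtto_graph (fs k) (vs k)"
    "(\<lambda>k. sqnorm (\<lambda>t i. fs k t i - f t i)) \<longlonglongrightarrow> 0" "(\<lambda>k. sqnorm (vs k)) \<longlonglongrightarrow> 0"
    using assms by (auto simp: null_lim_def)
  have L: "vLp 2 (\<lambda>t i. fs k t i - f t i)" for k
    using lin_closed_diff[OF lin_closed_vLp[of 2], of "fs k" f]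
      mtto_graph_vLp[OF fs(1)] null_lim_vLp[OF assms(1)] by auto
  \<comment> \<open>The values at 0 attained on the domain may form a proper subspace of C^n, so the
    correction is sought inside it.\<close>
  define S where "S = {a. \<exists>g w. mtto_graph g w \<and> a = val0 g}"
  have val0_comb: "(\<lambda>i. val0 g i + c * val0 h i) = val0 (\<lambda>t i. g t i + c * h t i)"
    if "vLp 2 g" "vLp 2 h" for g h :: "real \<Rightarrow> 'n \<Rightarrow> complex" and c
    using val0_add_cmult[OF that] by (simp add: fun_eq_iff)
  obtain \<phi> m where \<phi>: "\<And>j. \<phi> j \<in> S"
    and m: "\<And>a i. a \<in> S \<Longrightarrow> a i = (\<Sum>j\<in>UNIV. (\<Sum>l\<in>UNIV. m j l * a l) * \<phi> (j::'n) i)"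
  proof (rule subspace_linear_coordinates[of S])
    show "(\<lambda>i. 0) \<in> S"
      using mtto_graph_0 by (auto simp: S_def val0_def fcoef_def intro!: exI)
    show "(\<lambda>i. a i + c * b i) \<in> S" if "a \<in> S" "b \<in> S" for a b c
    proof -
      obtain g w h x where "mtto_graph g w" "a = val0 g" "mtto_graph h x" "b = val0 h"
        using \<open>a \<in> S\<close> \<open>b \<in> S\<close> by (auto simp: S_def)
      then show ?thesis
        unfolding S_def using mtto_graph_add_cmult[of g w h x c] val0_comb[of g h c] mtto_graph_vLp(1)
        by (intro CollectI exI[of _ "\<lambda>t i. g t i + c * h t i"]
            exI[of _ "\<lambda>t i. w t i + c * x t i"]) auto
    qed
  qed blast
  obtain X Y where X: "\<And>j. mtto_graph (X j) (Y j)" "\<And>j. val0 (X j) = \<phi> j"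
  proof -
    have "\<forall>j. \<exists>gw. mtto_graph (fst gw) (snd gw) \<and> val0 (fst gw) = \<phi> j"
    proof
      fix j
      obtain g w where "mtto_graph g w" "\<phi> j = val0 g"
        using \<phi>[of j] by (auto simp: S_def)
      then show "\<exists>gw. mtto_graph (fst gw) (snd gw) \<and> val0 (fst gw) = \<phi> j"
        by (intro exI[of _ "(g, w)"]) simp
    qed
    from choice[OF this] obtain gw where
      "\<forall>j. mtto_graph (fst (gw j)) (snd (gw j)) \<and> val0 (fst (gw j)) = \<phi> j" ..
    then show ?thesis
      using that[of "\<lambda>j. fst (gw j)" "\<lambda>j. snd (gw j)"] by simp
  qed
  \<comment> \<open>Minus the coordinates of \<open>val0 (fs k)\<close> with respect to
    \<open>\<phi> j = val0 (X j)\<close>: the correction cancels the value at 0, and being linear in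
    that value it tends to 0.\<close>
  define c where "c k j = - (\<Sum>l\<in>UNIV. m j l * val0 (fs k) l)" for k j
  define fs' where "fs' k = (\<lambda>t i. fs k t i + (\<Sum>j\<in>UNIV. c k j * X j t i))" for k
  define vs' where "vs' k = (\<lambda>t i. vs k t i + (\<Sum>j\<in>UNIV. c k j * Y j t i))" for k
  have sum: "mtto_graph (\<lambda>t i. \<Sum>j\<in>UNIV. c k j * X j t i) (\<lambda>t i. \<Sum>j\<in>UNIV. c k j * Y j t i)" for k
    by (rule mtto_graph_sum[OF X(1)])
  have graph: "mtto_graph (fs' k) (vs' k)" for k
    using mtto_graph_add_cmult[OF fs(1)[of k] sum[of k], of 1]
    by (simp add: fs'_def vs'_def)
  \<comment> \<open>As \<open>f\<close> vanishes at 0, the values of the approximants there are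
    those of a null sequence.\<close>
  have "val0 (fs k) i = val0 (\<lambda>t i. fs k t i - f t i) i" for k i
    using val0_add_cmult[OF mtto_graph_vLp(1)[OF fs(1)] null_lim_vLp[OF assms(1)], of k "-1" i] assms(2)
    by simp
  then have "(\<lambda>k. val0 (fs k) i) \<longlonglongrightarrow> 0" for i
    using val0_tendsto_0[OF L fs(2)] by simp
  then have "(\<lambda>k. - (\<Sum>l\<in>UNIV. m j l * val0 (fs k) l)) \<longlonglongrightarrow> - 0" for j
    by (intro tendsto_minus tendsto_null_sum tendsto_mult_right_zero)
  then have c0: "(\<lambda>k. c k j) \<longlonglongrightarrow> 0" for j
    by (simp add: c_def)
  have val0: "val0 (fs' k) = (\<lambda>i. 0)" for k
  proof
    fix i
    have "val0 (fs' k) i = val0 (fs k) i + 1 * val0 (\<lambda>t i. \<Sum>j\<in>UNIV. c k j * X j t i) i"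
      using val0_add_cmult[OF mtto_graph_vLp(1)[OF fs(1)[of k]] mtto_graph_vLp(1)[OF sum[of k]], of 1 i]
      by (simp add: fs'_def)
    also have "\<dots> = val0 (fs k) i - (\<Sum>j\<in>UNIV. (\<Sum>l\<in>UNIV. m j l * val0 (fs k) l) * \<phi> j i)"
      using val0_sum[of X "c k" UNIV i, OF mtto_graph_vLp(1)[OF X(1)]] by (simp add: X(2) c_def sum_negf)
    also have "\<dots> = 0"
      using m[of "val0 (fs k)" i] fs(1) unfolding S_def by auto
    finally show "val0 (fs' k) i = 0" .
  qed
  have "(\<lambda>k. sqnorm (\<lambda>t i. (fs k t i - f t i) + (\<Sum>j\<in>UNIV. c k j * X j t i))) \<longlonglongrightarrow> 0"
    by (intro sqnorm_lincomb_tendsto_0 L mtto_graph_vLp(1)[OF X(1)] fs(2) c0)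
  moreover have "(\<lambda>t i. (fs k t i - f t i) + (\<Sum>j\<in>UNIV. c k j * X j t i)) =
      (\<lambda>t i. fs' k t i - f t i)" for k
    by (simp add: fs'_def fun_eq_iff)
  ultimately have lim: "(\<lambda>k. sqnorm (\<lambda>t i. fs' k t i - f t i)) \<longlonglongrightarrow> 0"
    by simp
  have "(\<lambda>k. sqnorm (vs' k)) \<longlonglongrightarrow> 0"
    unfolding vs'_def
    by (intro sqnorm_lincomb_tendsto_0 mtto_graph_vLp(2)[OF X(1)] mtto_graph_vLp(2)[OF fs(1)] fs(3) c0)
  with graph val0 lim show ?thesis
    by (rule that)
qed

lemma null_lim_bshift:
  assumes "null_lim f" "val0 f = (\<lambda>i. 0)" "\<And>j. defect_coef \<Theta> G f j = 0"
  shows "null_lim (bshift f)"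
proof -
  obtain fs vs where fs: "\<And>k. mtto_graph (fs k) (vs k)" "\<And>k. val0 (fs k) = (\<lambda>i. 0)"
    "(\<lambda>k. sqnorm (\<lambda>t i. fs k t i - f t i)) \<longlonglongrightarrow> 0" "(\<lambda>k. sqnorm (vs k)) \<longlonglongrightarrow> 0"
    by (rule null_lim_vanishing_approximation[OF assms(1,2)]) blast
  define c where "c k j = defect_coef \<Theta> G (fs k) j / (2 * pi)" for k j
  define B where "B j = bshift (mvmult \<Theta> (\<lambda>t. unit_vec j))" for j
  define ws where "ws k = (\<lambda>t i. bshift (vs k) t i + (\<Sum>j\<in>UNIV. c k j * B j t i))" for k
  have L: "vLp 2 (\<lambda>t i. fs k t i - f t i)" for k
    using lin_closed_diff[OF lin_closed_vLp[of 2], of "fs k" f]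
      mtto_graph_vLp[OF fs(1)] null_lim_vLp[OF assms(1)] by auto
  have "mtto_graph (bshift (fs k)) (ws k)" for k
  proof -
    have "bshift (fs k) \<in> mtto_dom \<Theta>"
      using fs(1)[of k] inner
      by (auto simp: mtto_graph_def mtto_dom_def intro: bshift_model_space vHp_bshift)
    moreover have "is_PK \<Theta> (mvmult G (bshift (fs k))) (ws k)"
      unfolding ws_def c_def B_def using fs(1)[of k]
      by (intro is_PK_bshift inner symbol fs(2)) (auto simp: mtto_graph_def)
    ultimately show ?thesis
      by (simp add: mtto_graph_def)
  qed
  moreover have "(\<lambda>k. sqnorm (\<lambda>t i. bshift (fs k) t i - bshift f t i)) \<longlonglongrightarrow> 0"
  proof -
    \<comment> \<open>All these functions vanish at 0, where the backward shift is multiplication by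
      a unimodular function.\<close>
    have "sqnorm (\<lambda>t i. bshift (fs k) t i - bshift f t i) = sqnorm (\<lambda>t i. fs k t i - f t i)" for k
    proof -
      have "(\<lambda>t i. bshift (fs k) t i - bshift f t i) =
          (\<lambda>t i. exp (- \<i> * of_real t) * (fs k t i - f t i))"
        by (simp only: bshift_eq_if_val0_eq_0 fs(2) assms(2) right_diff_distrib)
      then show ?thesis
        by (simp only: sqnorm_unimodular_mult norm_exp_circ)
    qed
    then show ?thesis
      using fs(3) by simp
  qed
  moreover have "(\<lambda>k. sqnorm (ws k)) \<longlonglongrightarrow> 0"
    unfolding ws_def
  proof (rule sqnorm_lincomb_tendsto_0)
    show "vLp 2 (bshift (vs k))" for k
      using fs(1)[of k] by (auto simp: mtto_graph_def is_PK_def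
          intro: model_space_vLp bshift_model_space[OF inner])
    show "vLp 2 (B j)" for j
      unfolding B_def by (rule model_space_vLp[OF bshift_inner_model_space[OF inner]])
    show "(\<lambda>k. sqnorm (bshift (vs k))) \<longlonglongrightarrow> 0"
      by (intro sqnorm_bshift_tendsto_0 mtto_graph_vLp(2)[OF fs(1)] fs(4))
    fix j
    \<comment> \<open>The defect coefficients of \<open>f\<close> are 0, so those of
      \<open>fs k\<close> are the coefficients of a null sequence.\<close>
    have "defect_coef \<Theta> G (fs k) j = defect_coef \<Theta> G (\<lambda>t i. fs k t i - f t i) j" for k
      using defect_coef_add_cmult[OF inner symbol mtto_graph_vLp(1)[OF fs(1)[of k]]
          null_lim_vLp[OF assms(1)], of "-1" j] assms(3) by simp
    moreover have "(\<lambda>k. defect_coef \<Theta> G (\<lambda>t i. fs k t i - f t i) j) \<longlonglongrightarrow> 0"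
      unfolding defect_coef_def
      by (intro vinner_tendsto_0 L vLp_mvadj symbol vLp_infinity_mvmult_const matrix_inner_mLp inner fs(3))
    ultimately show "(\<lambda>k. c k j) \<longlonglongrightarrow> 0"
      unfolding c_def by (intro tendsto_divide_zero) simp
  qed
  ultimately show ?thesis
    unfolding null_lim_def using bshift_model_space[OF inner null_lim_model_space[OF assms(1)]]
    by (intro conjI exI[of _ "\<lambda>k. bshift (fs k)"] exI[of _ ws]) auto
qed

text \<open>The coefficient vectors of kernel elements vanishing at 0 form a subspace of C^n;
  elements \<open>X j\<close> realising a spanning family of it are enough, since a combination of
  them carries all coefficients of \<open>f\<close>.\<close>

lemma null_lim_nearly_invariant:
  obtains d :: "'n \<Rightarrow> real \<Rightarrow> 'n \<Rightarrow> complex" where "\<And>j. vHp 2 (d j)"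
    "\<And>f. null_lim f \<Longrightarrow> val0 f = (\<lambda>i. 0) \<Longrightarrow>
       \<exists>g c. null_lim g \<and> (\<forall>t i. bshift f t i = g t i + (\<Sum>j\<in>UNIV. c j * d j t i))"
proof -
  define S where "S = {a. \<exists>f. null_lim f \<and> val0 f = (\<lambda>i. 0) \<and> a = defect_coef \<Theta> G f}"
  have val0_comb: "val0 (\<lambda>t i. f t i + c * g t i) = (\<lambda>i. 0)"
    if "null_lim f" "val0 f = (\<lambda>i. 0)" "null_lim g" "val0 g = (\<lambda>i. 0)" for f g c
    using val0_add_cmult[OF null_lim_vLp[OF that(1)] null_lim_vLp[OF that(3)]] that
    by (simp add: fun_eq_iff)
  obtain \<phi> m where \<phi>: "\<And>j. \<phi> j \<in> S"
    and m: "\<And>a i. a \<in> S \<Longrightarrow> a i = (\<Sum>j\<in>UNIV. (\<Sum>l\<in>UNIV. m j l * a l) * \<phi> (j::'n) i)"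
  proof (rule subspace_linear_coordinates[of S])
    have "defect_coef \<Theta> G (\<lambda>t i. 0) = (\<lambda>i. 0)" "val0 (\<lambda>t (i::'n). 0) = (\<lambda>i. 0)"
      by (simp_all add: fun_eq_iff defect_coef_def val0_def fcoef_def)
    then show "(\<lambda>i. 0) \<in> S"
      using lin_closed_0[OF lin_closed_null_lim] unfolding S_def by (metis (mono_tags, lifting) mem_Collect_eq)
    show "(\<lambda>i. a i + c * b i) \<in> S" if "a \<in> S" "b \<in> S" for a b c
    proof -
      obtain f g where f: "null_lim f" "val0 f = (\<lambda>i. 0)" "a = defect_coef \<Theta> G f"
        and g: "null_lim g" "val0 g = (\<lambda>i. 0)" "b = defect_coef \<Theta> G g"
        using \<open>a \<in> S\<close> \<open>b \<in> S\<close> by (auto simp: S_def)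
      have "(\<lambda>i. a i + c * b i) = defect_coef \<Theta> G (\<lambda>t i. f t i + c * g t i)"
        using defect_coef_add_cmult[OF inner symbol null_lim_vLp[OF f(1)] null_lim_vLp[OF g(1)]]
        by (simp add: f(3) g(3) fun_eq_iff)
      then show ?thesis
        unfolding S_def using lin_closed_add_cmult[OF lin_closed_null_lim, of f g c] f(1) g(1)
          val0_comb[OF f(1,2) g(1,2)] by blast
    qed
  qed blast
  obtain X where X: "\<And>j. null_lim (X j)" "\<And>j. val0 (X j) = (\<lambda>i. 0)" "\<And>j. \<phi> j = defect_coef \<Theta> G (X j)"
  proof -
    have "\<forall>j. \<exists>f. null_lim f \<and> val0 f = (\<lambda>i. 0) \<and> \<phi> j = defect_coef \<Theta> G f"
      using \<phi> by (simp add: S_def)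
    from choice[OF this] show ?thesis
      using that by blast
  qed
  show ?thesis
  proof (rule that[of "\<lambda>j. bshift (X j)"])
    show "vHp 2 (bshift (X j))" for j
      by (rule model_space_vHp[OF bshift_model_space[OF inner null_lim_model_space[OF X(1)]]])
    fix f
    assume f: "null_lim f" "val0 f = (\<lambda>i. 0)"
    define c where "c j = (\<Sum>l\<in>UNIV. m j l * defect_coef \<Theta> G f l)" for j
    define s where "s = (\<lambda>t i. \<Sum>j\<in>UNIV. c j * X j t i)"
    \<comment> \<open>\<open>s\<close> has the same defect coefficients as \<open>f\<close>, so
      those of \<open>g\<close> vanish and its backward shift stays in the kernel.\<close>
    define g where "g = (\<lambda>t i. f t i + (-1) * s t i)"
    have s: "null_lim s"
      unfolding s_def by (rule lin_closed_sum[OF lin_closed_null_lim], rule X(1))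
    have val0_s: "val0 s = (\<lambda>i. 0)"
      using val0_sum[of X c UNIV, OF null_lim_vLp[OF X(1)]] by (simp add: s_def fun_eq_iff X(2))
    have g: "null_lim g" "val0 g = (\<lambda>i. 0)"
      unfolding g_def
      using lin_closed_add_cmult[OF lin_closed_null_lim, of f s "-1"] f(1) s
        val0_comb[OF f s val0_s, of "-1"] by auto
    have "defect_coef \<Theta> G g i = 0" for i
    proof -
      have "defect_coef \<Theta> G g i = defect_coef \<Theta> G f i + (-1) * defect_coef \<Theta> G s i"
        unfolding g_def by (intro defect_coef_add_cmult inner symbol null_lim_vLp f s)
      also have "defect_coef \<Theta> G s i = (\<Sum>j\<in>UNIV. c j * \<phi> j i)"
        unfolding s_def X(3) by (intro defect_coef_sum inner symbol null_lim_vLp X)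
      also have "\<dots> = defect_coef \<Theta> G f i"
        unfolding c_def by (rule m[symmetric]) (use f in \<open>auto simp: S_def\<close>)
      finally show ?thesis
        by simp
    qed
    then have "null_lim (bshift g)"
      by (intro null_lim_bshift g)
    moreover have "bshift f t i = bshift g t i + (\<Sum>j\<in>UNIV. c j * bshift (X j) t i)" for t i
    proof -
      have "f t i = g t i + (\<Sum>j\<in>UNIV. c j * X j t i)"
        by (simp add: g_def s_def)
      then show ?thesis
        by (simp add: bshift_def f(2) g(2) X(2) sum_distrib_right distrib_right mult.assoc)
    qed
    ultimately show "\<exists>g c. null_lim g \<and>
        (\<forall>t i. bshift f t i = g t i + (\<Sum>j\<in>UNIV. c j * bshift (X j) t i))"
      by blast
  qed
qed

end

text \<open>The defect space is the span of the family \<open>d\<close>; indexing by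
  \<open>'n\<close> bounds its dimension by n. Equality is almost everywhere because elements of the
  kernel are representatives.\<close>

theorem theorem3p3:
  fixes \<Theta> :: "real \<Rightarrow> 'n::finite \<Rightarrow> 'n \<Rightarrow> complex"
    and G :: "real \<Rightarrow> 'n \<Rightarrow> 'n \<Rightarrow> complex"
    and p :: ereal
  assumes "matrix_inner \<Theta>"
    and "2 < p"
    and "mLp p G"
    and "is_MTTO \<Theta> G"
  shows "\<exists>d :: 'n \<Rightarrow> real \<Rightarrow> 'n \<Rightarrow> complex.
           (\<forall>j. vHp 2 (d j)) \<and>
           (\<forall>f\<in>MTTO_ker \<Theta> G. val0 f = (\<lambda>i. 0) \<longrightarrow>
              (\<exists>k\<in>MTTO_ker \<Theta> G. \<exists>c :: 'n \<Rightarrow> complex.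
                 AE t in circ. \<forall>i. bshift f t i = k t i + (\<Sum>j\<in>UNIV. c j * d j t i)))"
proof -
  have "mLp 2 G"
    using Lp_circ_imp_2[OF assms(2)] assms(3) by (simp add: mLp_def)
  with assms interpret bounded_mtto \<Theta> G
    by unfold_locales
  show ?thesis
  proof (cases "\<forall>f\<in>model_space \<Theta>. approximable f")
    case True
    obtain d :: "'n \<Rightarrow> real \<Rightarrow> 'n \<Rightarrow> complex" where d: "\<And>j. vHp 2 (d j)"
      "\<And>f. null_lim f \<Longrightarrow> val0 f = (\<lambda>i. 0) \<Longrightarrow>
         \<exists>g c. null_lim g \<and> (\<forall>t i. bshift f t i = g t i + (\<Sum>j\<in>UNIV. c j * d j t i))"
      by (rule null_lim_nearly_invariant) blast
    have "\<exists>k\<in>MTTO_ker \<Theta> G. \<exists>c :: 'n \<Rightarrow> complex.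
        AE t in circ. \<forall>i. bshift f t i = k t i + (\<Sum>j\<in>UNIV. c j * d j t i)"
      if "f \<in> MTTO_ker \<Theta> G" "val0 f = (\<lambda>i. 0)" for f
    proof -
      have "null_lim f"
        using that(1) True by (intro ker_imp_null_lim) (auto simp: MTTO_ker_iff)
      from d(2)[OF this that(2)] obtain g c where
        g: "null_lim g" "\<And>t i. bshift f t i = g t i + (\<Sum>j\<in>UNIV. c j * d j t i)"
        by blast
      show ?thesis
        by (intro bexI[of _ g] exI[of _ c] AE_I2 allI g(2) null_lim_imp_ker g(1))
    qed
    with d(1) show ?thesis
      by blast
  next
    case False
    \<comment> \<open>The domain is in fact dense in the model space; without density the definition of the kernel
      would admit every element that is not a limit, and then one defect vector suffices.\<close>
    then obtain e where e: "e \<in> model_space \<Theta>" "\<not> approximable e"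
      by blast
    \<comment> \<open>Every defect vector will be \<open>e\<close>, so one arbitrary index carries
      the coefficient 1 and all others 0.\<close>
    define j0 :: 'n where "j0 = undefined"
    have "\<exists>k\<in>MTTO_ker \<Theta> G. \<exists>c :: 'n \<Rightarrow> complex.
        AE t in circ. \<forall>i. bshift f t i = k t i + (\<Sum>j\<in>UNIV. c j * e t i)"
      if "f \<in> MTTO_ker \<Theta> G" for f
    proof -
      have bf: "bshift f \<in> model_space \<Theta>"
        using that by (intro bshift_model_space inner) (simp add: MTTO_ker_iff)
      show ?thesis
      proof (cases "approximable (bshift f)")
        case True
        \<comment> \<open>Subtracting \<open>e\<close> leaves the approximable elements and thereby
          enters the kernel.\<close>
        define k where "k = (\<lambda>t i. bshift f t i - e t i)"
        have k: "k \<in> model_space \<Theta>"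
          using lin_closed_diff[OF lin_closed_model_space[OF inner], of "bshift f" e] bf e(1)
          by (simp add: k_def)
        have "e = (\<lambda>t i. bshift f t i - k t i)"
          by (simp add: k_def)
        then have "\<not> approximable k"
          using approximable_diff[OF bf k True] e(2) by auto
        then have "k \<in> MTTO_ker \<Theta> G"
          using k by (intro not_approximable_imp_ker)
        moreover have "bshift f t i = k t i + (\<Sum>j\<in>UNIV. unit_vec j0 j * e t i)" for t i
          by (simp add: k_def unit_vec_def if_distrib[of "\<lambda>x. x * _"] cong: if_cong)
        ultimately show ?thesis
          by (intro bexI[of _ k] exI[of _ "unit_vec j0"]) auto
      next
        case False
        then show ?thesis
          using not_approximable_imp_ker[OF bf]
          by (intro bexI[of _ "bshift f"] exI[of _ "\<lambda>j. 0"]) auto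
      qed
    qed
    then show ?thesis
      using model_space_vHp[OF e(1)] by (intro exI[of _ "\<lambda>j. e"]) blast
  qed
qed

end
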